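(* Let $H$ be a Hilbert space and let $X\subseteq\mathcal B(H)$ be a unital operator space. If $\mathcal I$ is a maximal boundary subsystem for $X$ in $\mathcal B(H)$, then $(\mathcal B(H)/\mathcal I,q_{\mathcal I})$ is an injective envelope for $X$, where $q_{\mathcal I}$ is the (restriction to $X$ of the) quotient map $\mathcal B(H)\to\mathcal B(H)/\mathcal I$.
   Context: $X$ is a linear subspace of $\mathcal B(H)$ containing $I_H$, with the inherited matrix norms on $M_\nu(X)\subseteq M_\nu(\mathcal B(H))=\mathcal B(H^\nu)$. All operator spaces and morphisms are unital. For a linear map $\phi$ put $\phi_\nu([a_{ij}])=[\phi(a_{ij})]$; a unital linear map $\phi$ is ucc, resp. ucis, if every $\phi_\nu$, $\nu\in\mathbb N$, is contractive, resp. isometric. For a selfadjoint linear subspace $\mathcal I\subseteq\mathcal B(H)$, the quotient $\mathcal B(H)/\mathcal I$ carries the matrix norms $\|[a_{ij}+\mathcal I]\|_\nu=\inf\{\|[a_{ij}+y_{ij}]\|_\nu : y_{ij}\in\mathcal I\}$ and the unit $I_H+\mathcal I$. Such an $\mathcal I$ (not required to contain the unit) is a boundary subsystem for $X$ in $\mathcal B(H)$ if $q_{\mathcal I}|_X$ is completely isometric; maximal means maximal with respect to inclusion. An operator space $E$ is injective if for all operator spaces $Z\subseteq Y$ every ucc map $Z\to E$ extends to a ucc map $Y\to E$. An extension of $X$ is a pair $(E,\iota)$ with $E$ an operator space and $\iota\colon X\to E$ ucis. It is an injective envelope of $X$ if $E$ is injective and no proper injective subspace of $E$ contains $\iota(X)$;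 for an injective extension this is equivalent to rigidity: $\mathrm{id}_E$ is the only ucc map $E\to E$ extending the identity of $\iota(X)$. *)

theory Defs
  imports "HOL-Analysis.Analysis" "HOL-Library.Set_Algebras"
begin

section \<open>Complex Hilbert spaces and their bounded operators\<close>

text \<open>The inner product is conjugate linear in the first argument. The zero space is allowed.\<close>

class complex_hilbert_space = banach +
  fixes scaleC :: "complex \<Rightarrow> 'a \<Rightarrow> 'a"  (infixr "*\<^sub>C" 75)
    and cinner :: "'a \<Rightarrow> 'a \<Rightarrow> complex"
  assumes scaleC_add_right: "c *\<^sub>C (x + y) = c *\<^sub>C x + c *\<^sub>C y"
    and scaleC_add_left: "(c + d) *\<^sub>C x = c *\<^sub>C x + d *\<^sub>C x"
    and scaleC_scaleC: "c *\<^sub>C (d *\<^sub>C x) = (c * d) *\<^sub>C x"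
    and scaleC_of_real: "complex_of_real r *\<^sub>C x = r *\<^sub>R x"
    and cinner_commute: "cinner x y = cnj (cinner y x)"
    and cinner_add_right: "cinner x (y + z) = cinner x y + cinner x z"
    and cinner_scaleC_right: "cinner x (c *\<^sub>C y) = c * cinner x y"
    and cinner_self: "cinner x x = complex_of_real ((norm x)\<^sup>2)"

instantiation complex :: complex_hilbert_space
begin

definition scaleC_complex :: "complex \<Rightarrow> complex \<Rightarrow> complex"
  where "scaleC_complex c x = c * x"

definition cinner_complex :: "complex \<Rightarrow> complex \<Rightarrow> complex"
  where "cinner_complex x y = cnj x * y"

instance
proof
  show "cinner x x = complex_of_real ((norm x)\<^sup>2)" for x :: complex
    by (simp only: cinner_complex_def complex_norm_square mult.commute)
qed (simp_all add: scaleC_complex_def cinner_complex_def algebra_simps scaleR_conv_of_real)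

end

lemma norm_scaleC: "norm (c *\<^sub>C x) = cmod c * norm (x :: 'a :: complex_hilbert_space)"
proof -
  have "cinner (c *\<^sub>C x) (c *\<^sub>C x) = c * cnj (cinner x (c *\<^sub>C x))"
    using cinner_commute[of "c *\<^sub>C x" x] by (simp add: cinner_scaleC_right)
  also have "\<dots> = c * cnj c * cnj (cinner x x)"
    by (simp add: cinner_scaleC_right)
  also have "\<dots> = complex_of_real ((cmod c)\<^sup>2 * (norm x)\<^sup>2)"
    by (simp only: cinner_self of_real_mult complex_norm_square[of c] complex_cnj_complex_of_real)
  finally have "(norm (c *\<^sub>C x))\<^sup>2 = (cmod c * norm x)\<^sup>2"
    by (simp only: cinner_self of_real_eq_iff power_mult_distrib)
  then show ?thesis
    by (simp add: power2_eq_iff_nonneg)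
qed

lemma bounded_linear_scaleC: "bounded_linear (\<lambda>x :: 'a :: complex_hilbert_space. c *\<^sub>C x)"
proof
  show "c *\<^sub>C (r *\<^sub>R x) = r *\<^sub>R (c *\<^sub>C x)" for r and x :: 'a
    by (simp add: scaleC_of_real[symmetric] scaleC_scaleC mult.commute)
  show "\<exists>K. \<forall>x :: 'a. norm (c *\<^sub>C x) \<le> norm x * K"
    by (rule exI[of _ "cmod c"]) (simp add: norm_scaleC mult.commute)
qed (rule scaleC_add_right)

text \<open>The type \<open>'h \<Rightarrow>\<^sub>L 'h\<close> of the library consists of the bounded \<^emph>\<open>real\<close> linear maps, with the
  operator norm; \<open>B(H)\<close> is the subset of the complex linear ones.\<close>

definition bounded_ops :: "('h :: complex_hilbert_space \<Rightarrow>\<^sub>L 'h) set"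
  where "bounded_ops = {T. \<forall>c x. blinfun_apply T (c *\<^sub>C x) = c *\<^sub>C blinfun_apply T x}"

lift_definition scaleC_op ::
    "complex \<Rightarrow> ('h :: complex_hilbert_space \<Rightarrow>\<^sub>L 'h) \<Rightarrow> ('h \<Rightarrow>\<^sub>L 'h)"
  is "\<lambda>c T x. c *\<^sub>C T x"
  by (rule bounded_linear_compose[OF bounded_linear_scaleC])

global_interpretation cop:
  vector_space "scaleC_op :: complex \<Rightarrow> ('h :: complex_hilbert_space \<Rightarrow>\<^sub>L 'h) \<Rightarrow> ('h \<Rightarrow>\<^sub>L 'h)"
proof
  have one: "1 *\<^sub>C x = x" for x :: 'h
    using scaleC_of_real[of 1 x] by simp
  show "scaleC_op 1 T = T" for T :: "'h \<Rightarrow>\<^sub>L 'h"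
    by transfer (simp add: one)
qed (transfer, simp add: scaleC_add_right scaleC_add_left scaleC_scaleC)+

definition is_adjoint ::
    "('h :: complex_hilbert_space \<Rightarrow>\<^sub>L 'h) \<Rightarrow> ('h \<Rightarrow>\<^sub>L 'h) \<Rightarrow> bool"
  where "is_adjoint S T \<longleftrightarrow>
    (\<forall>x y. cinner (blinfun_apply S x) y = cinner x (blinfun_apply T y))"

definition selfadjoint_set :: "('h :: complex_hilbert_space \<Rightarrow>\<^sub>L 'h) set \<Rightarrow> bool"
  where "selfadjoint_set I \<longleftrightarrow> (\<forall>T\<in>I. \<exists>S\<in>I. is_adjoint S T)"

text \<open>The norm of \<open>[a\<^sub>i\<^sub>j]\<close> in \<open>M\<^sub>n(B(H)) = B(H\<^sup>n)\<close>. Vectors of \<open>H\<^sup>n\<close> and \<open>n \<times> n\<close> matrices are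
  functions on \<open>nat\<close> of which only the values at indices below \<open>n\<close> matter.\<close>

definition op_matrix_norm ::
    "nat \<Rightarrow> (nat \<Rightarrow> nat \<Rightarrow> ('h :: complex_hilbert_space \<Rightarrow>\<^sub>L 'h)) \<Rightarrow> real"
  where "op_matrix_norm n a =
    (SUP \<xi> \<in> {\<xi> :: nat \<Rightarrow> 'h. L2_set (\<lambda>j. norm (\<xi> j)) {..<n} \<le> 1}.
       L2_set (\<lambda>i. norm (\<Sum>j<n. blinfun_apply (a i j) (\<xi> j))) {..<n})"


section \<open>Unital matrix normed spaces and their morphisms\<close>

text \<open>Raw structure shared by subspaces of \<open>B(H)\<close> and by quotients \<open>B(H)/I\<close>.\<close>

record 'a matrix_normed_space =
  carr :: "'a set"
  vadd :: "'a \<Rightarrow> 'a \<Rightarrow> 'a"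
  vscale :: "complex \<Rightarrow> 'a \<Rightarrow> 'a"
  vunit :: "'a"
  mnorm :: "nat \<Rightarrow> (nat \<Rightarrow> nat \<Rightarrow> 'a) \<Rightarrow> real"

definition matrices :: "'a matrix_normed_space \<Rightarrow> nat \<Rightarrow> (nat \<Rightarrow> nat \<Rightarrow> 'a) set"
  where "matrices E n = {a. \<forall>i<n. \<forall>j<n. a i j \<in> carr E}"

definition linear_map ::
    "'a matrix_normed_space \<Rightarrow> 'b matrix_normed_space \<Rightarrow> ('a \<Rightarrow> 'b) \<Rightarrow> bool"
  where "linear_map E F \<phi> \<longleftrightarrow>
    \<phi> ` carr E \<subseteq> carr F \<and>
    (\<forall>a\<in>carr E. \<forall>b\<in>carr E. \<phi> (vadd E a b) = vadd F (\<phi> a) (\<phi> b)) \<and>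
    (\<forall>c. \<forall>a\<in>carr E. \<phi> (vscale E c a) = vscale F c (\<phi> a))"

definition completely_contractive ::
    "'a matrix_normed_space \<Rightarrow> 'b matrix_normed_space \<Rightarrow> ('a \<Rightarrow> 'b) \<Rightarrow> bool"
  where "completely_contractive E F \<phi> \<longleftrightarrow> linear_map E F \<phi> \<and>
    (\<forall>n\<ge>1. \<forall>a\<in>matrices E n. mnorm F n (\<lambda>i j. \<phi> (a i j)) \<le> mnorm E n a)"

definition completely_isometric ::
    "'a matrix_normed_space \<Rightarrow> 'b matrix_normed_space \<Rightarrow> ('a \<Rightarrow> 'b) \<Rightarrow> bool"
  where "completely_isometric E F \<phi> \<longleftrightarrow> linear_map E F \<phi> \<and>
    (\<forall>n\<ge>1. \<forall>a\<in>matrices E n. mnorm F n (\<lambda>i j. \<phi> (a i j)) = mnorm E n a)"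

definition ucc :: "'a matrix_normed_space \<Rightarrow> 'b matrix_normed_space \<Rightarrow> ('a \<Rightarrow> 'b) \<Rightarrow> bool"
  where "ucc E F \<phi> \<longleftrightarrow> completely_contractive E F \<phi> \<and> \<phi> (vunit E) = vunit F"

definition ucis :: "'a matrix_normed_space \<Rightarrow> 'b matrix_normed_space \<Rightarrow> ('a \<Rightarrow> 'b) \<Rightarrow> bool"
  where "ucis E F \<phi> \<longleftrightarrow> completely_isometric E F \<phi> \<and> \<phi> (vunit E) = vunit F"

text \<open>\<open>S\<close> is the carrier of a unital subspace of \<open>E\<close>; that subspace itself is \<open>E\<lparr>carr := S\<rparr>\<close>.\<close>

definition unital_subspace :: "'a matrix_normed_space \<Rightarrow> 'a set \<Rightarrow> bool"
  where "unital_subspace E S \<longleftrightarrow>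
    S \<subseteq> carr E \<and> vunit E \<in> S \<and>
    (\<forall>a\<in>S. \<forall>b\<in>S. vadd E a b \<in> S) \<and> (\<forall>c. \<forall>a\<in>S. vscale E c a \<in> S)"


section \<open>Operator spaces\<close>

definition concrete_operator_space :: "('h :: complex_hilbert_space \<Rightarrow>\<^sub>L 'h) set \<Rightarrow> bool"
  where "concrete_operator_space X \<longleftrightarrow>
    X \<subseteq> bounded_ops \<and> cop.subspace X \<and> id_blinfun \<in> X"

definition op_space ::
    "('h :: complex_hilbert_space \<Rightarrow>\<^sub>L 'h) set \<Rightarrow> ('h \<Rightarrow>\<^sub>L 'h) matrix_normed_space"
  where "op_space X =
    \<lparr>carr = X, vadd = (+), vscale = scaleC_op, vunit = id_blinfun, mnorm = op_matrix_norm\<rparr>"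

text \<open>\<open>E\<close> is, up to unital completely isometric linear isomorphism, an operator space on the Hilbert
  space \<open>'w\<close>. The closure conditions in \<open>unital_subspace E (carr E)\<close> make the transported structure
  a vector space.\<close>

definition operator_space ::
    "'w :: complex_hilbert_space itself \<Rightarrow> 'a matrix_normed_space \<Rightarrow> bool"
  where "operator_space _ E \<longleftrightarrow>
    unital_subspace E (carr E) \<and>
    (\<exists>(Y :: ('w \<Rightarrow>\<^sub>L 'w) set) \<phi>. concrete_operator_space Y \<and>
       bij_betw \<phi> (carr E) Y \<and> ucis E (op_space Y) \<phi>)"

text \<open>Injectivity of \<open>E\<close> tested on all operator spaces \<open>Z \<subseteq> Y\<close> on the Hilbert space \<open>'k\<close>.\<close>

definition injective ::
    "'k :: complex_hilbert_space itself \<Rightarrow> 'a matrix_normed_space \<Rightarrow> bool"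
  where "injective _ E \<longleftrightarrow>
    (\<forall>Z Y :: ('k \<Rightarrow>\<^sub>L 'k) set.
       concrete_operator_space Z \<longrightarrow> concrete_operator_space Y \<longrightarrow> Z \<subseteq> Y \<longrightarrow>
       (\<forall>\<phi>. ucc (op_space Z) E \<phi> \<longrightarrow>
          (\<exists>\<psi>. ucc (op_space Y) E \<psi> \<and> (\<forall>z\<in>Z. \<psi> z = \<phi> z))))"

definition extension ::
    "'w :: complex_hilbert_space itself \<Rightarrow> ('h :: complex_hilbert_space \<Rightarrow>\<^sub>L 'h) set \<Rightarrow>
     'a matrix_normed_space \<Rightarrow> (('h \<Rightarrow>\<^sub>L 'h) \<Rightarrow> 'a) \<Rightarrow> bool"
  where "extension w X E \<iota> \<longleftrightarrow> operator_space w E \<and> ucis (op_space X) E \<iota>"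

text \<open>Being an operator space and being injective refer to all Hilbert spaces, which no HOL formula
  can quantify over. Hence two type parameters. The type \<open>'k\<close> is used where \<open>E\<close> is required to be
  injective, a universal condition: the statement for every type \<open>'k\<close> expresses injectivity
  of \<open>E\<close>. The type \<open>'w\<close> is used for the existential conditions, that is, for representing \<open>E\<close> on
  some Hilbert space and for refuting injectivity of a proper subspace: whatever type is taken for
  \<open>'w\<close>, the condition on \<open>'w\<close> implies the condition on arbitrary Hilbert spaces. Thus the predicate,
  for one \<open>'w\<close> and all \<open>'k\<close>, implies being an injective envelope.\<close>

definition injective_envelope ::
    "'w :: complex_hilbert_space itself \<Rightarrow> 'k :: complex_hilbert_space itself \<Rightarrow>
     ('h :: complex_hilbert_space \<Rightarrow>\<^sub>L 'h) set \<Rightarrow>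
     'a matrix_normed_space \<Rightarrow> (('h \<Rightarrow>\<^sub>L 'h) \<Rightarrow> 'a) \<Rightarrow> bool"
  where "injective_envelope w k X E \<iota> \<longleftrightarrow>
    extension w X E \<iota> \<and> injective k E \<and>
    \<not> (\<exists>S. unital_subspace E S \<and> S \<noteq> carr E \<and> \<iota> ` X \<subseteq> S \<and> injective w (E\<lparr>carr := S\<rparr>))"


section \<open>Quotients and boundary subsystems\<close>

definition quot_map ::
    "('h :: complex_hilbert_space \<Rightarrow>\<^sub>L 'h) set \<Rightarrow> ('h \<Rightarrow>\<^sub>L 'h) \<Rightarrow> ('h \<Rightarrow>\<^sub>L 'h) set"
  where "quot_map I T = T +o I"

text \<open>Elements are cosets. Adding \<open>I\<close> in the scalar multiplication matters for the scalar \<open>0\<close>. The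
  representatives of \<open>a\<^sub>i\<^sub>j + I\<close> are exactly the operators \<open>a\<^sub>i\<^sub>j + y\<^sub>i\<^sub>j\<close> with \<open>y\<^sub>i\<^sub>j \<in> I\<close>.\<close>

definition quotient_space ::
    "('h :: complex_hilbert_space \<Rightarrow>\<^sub>L 'h) set \<Rightarrow> ('h \<Rightarrow>\<^sub>L 'h) set matrix_normed_space"
  where "quotient_space I =
    \<lparr>carr = quot_map I ` bounded_ops,
     vadd = (\<lambda>A B. A + B),
     vscale = (\<lambda>c A. scaleC_op c ` A + I),
     vunit = quot_map I id_blinfun,
     mnorm = (\<lambda>n A. Inf {op_matrix_norm n a | a. \<forall>i<n. \<forall>j<n. a i j \<in> A i j})\<rparr>"

lemma quotient_space_operations:
  assumes "cop.subspace I"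
  shows "vadd (quotient_space I) (quot_map I S) (quot_map I T) = quot_map I (S + T)"
    and "vscale (quotient_space I) c (quot_map I T) = quot_map I (scaleC_op c T)"
proof -
  note sub = cop.subspace_0[OF assms] cop.subspace_add[OF assms] cop.subspace_scale[OF assms]
  have II: "I + I = I"
  proof
    show "I + I \<subseteq> I"
      using sub(2) by (auto simp: set_plus_def)
    show "I \<subseteq> I + I"
      using set_zero_plus2[OF sub(1)] .
  qed
  show "vadd (quotient_space I) (quot_map I S) (quot_map I T) = quot_map I (S + T)"
    by (simp add: quotient_space_def quot_map_def set_plus_rearrange II)
  have cI: "scaleC_op c ` I + I = I"
  proof
    show "scaleC_op c ` I + I \<subseteq> I"
      using sub(2,3) by (auto simp: set_plus_def)
    have "0 \<in> scaleC_op c ` I"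
      using sub(1) by (rule rev_image_eqI) simp
    then show "I \<subseteq> scaleC_op c ` I + I"
      by (rule set_zero_plus2)
  qed
  have "scaleC_op c ` (T +o I) = scaleC_op c T +o scaleC_op c ` I"
  proof -
    have plus_image: "R +o J = (\<lambda>S. R + S) ` J" for R :: "'a \<Rightarrow>\<^sub>L 'a" and J
      by (auto simp: elt_set_plus_def)
    show ?thesis
      by (simp only: plus_image image_image cop.scale_right_distrib)
  qed
  then show "vscale (quotient_space I) c (quot_map I T) = quot_map I (scaleC_op c T)"
    by (simp add: quotient_space_def quot_map_def set_plus_rearrange3 cI)
qed

definition boundary_subsystem ::
    "('h :: complex_hilbert_space \<Rightarrow>\<^sub>L 'h) set \<Rightarrow> ('h \<Rightarrow>\<^sub>L 'h) set \<Rightarrow> bool"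
  where "boundary_subsystem X I \<longleftrightarrow>
    I \<subseteq> bounded_ops \<and> cop.subspace I \<and> selfadjoint_set I \<and>
    completely_isometric (op_space X) (quotient_space I) (quot_map I)"

definition maximal_boundary_subsystem ::
    "('h :: complex_hilbert_space \<Rightarrow>\<^sub>L 'h) set \<Rightarrow> ('h \<Rightarrow>\<^sub>L 'h) set \<Rightarrow> bool"
  where "maximal_boundary_subsystem X I \<longleftrightarrow>
    boundary_subsystem X I \<and> (\<forall>J. boundary_subsystem X J \<and> I \<subseteq> J \<longrightarrow> J = I)"

end

theory Submission
  imports Defs "HOL-Library.Function_Algebras"
begin

text \<open>
  Call a unital completely contractive map \<open>\<phi>: B(H) \<rightarrow> B(H)\<close> that is the identity on \<open>X\<close> and vanishes
  on \<open>I\<close> an annihilating \<open>X\<close>-map. The whole theorem follows from two facts about these maps.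

  \<^item> They exist (\<open>X_map_annihilating_exists\<close>). That \<open>q\<^sub>I\<close> is completely isometric on \<open>X\<close> says
    exactly that \<open>x + y \<mapsto> x\<close> is a well defined unital complete contraction on \<open>X + I\<close>, and by
    injectivity of \<open>B(H)\<close> (\<open>ucc_extension\<close>) it extends to \<open>B(H)\<close>.

  \<^item> For maximal \<open>I\<close>, every such map satisfies \<open>b - \<phi>(b) \<in> I\<close> (\<open>X_map_complement_in_boundary\<close>). Indeed
    \<open>J = (1 - \<phi>)(B(H))\<close> contains \<open>I\<close>, it is selfadjoint because \<open>\<phi>\<close> preserves adjoints, and it is
    again a boundary subsystem: averaging the iterates of \<open>\<phi>\<close> fixes \<open>X\<close> and makes the elements of
    \<open>J\<close> arbitrarily small, hence adding elements of \<open>J\<close> cannot decrease the norm of a matrix over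
    \<open>X\<close>. So \<open>J = I\<close>.

  Consequently \<open>\<phi>\<close> is idempotent with kernel \<open>I\<close>, and \<open>a + I \<mapsto> \<phi>(a)\<close> is a completely isometric
  isomorphism of \<open>B(H)/I\<close> onto the range of \<open>\<phi>\<close>; this makes the quotient an operator space on \<open>H\<close>,
  and it is injective because \<open>B(H)\<close> is and \<open>\<phi>\<close> projects onto the range. Let \<open>S\<close> be an
  injective subspace of \<open>B(H)/I\<close> containing the image of \<open>X\<close>. The isomorphism identifies \<open>S\<close> with a
  subspace of the range of \<open>\<phi>\<close>, whose identification with \<open>S\<close> extends to a map \<open>B(H) \<rightarrow> S\<close>. Preceded by
  \<open>\<phi>\<close> and followed by the isomorphism, this is another annihilating \<open>X\<close>-map, and the second fact
  applied to it says that every coset lies in \<open>S\<close>.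

  The injectivity of \<open>B(H)\<close> for unital complete contractions is the analytic core. In place of operator
  systems the proof works with accretive matrices, those with positive real part. A unital
  complete contraction preserves them, since \<open>Re a \<ge> 0\<close> holds if and only if \<open>\<parallel>1 - t a\<parallel>\<^sup>2 \<le> 1 + O(t\<^sup>2)\<close>
  as \<open>t \<rightarrow> 0+\<close> (\<open>ucc_accretive\<close>). Conversely \<open>\<parallel>a\<parallel> \<le> c\<close> says that the \<open>2 \<times> 2\<close> matrix with diagonal entries
  \<open>c\<close> and off-diagonal entries \<open>2 a\<close> and \<open>0\<close> is accretive. So an extension of \<open>\<phi>: Z \<rightarrow> B(H)\<close> is a
  positive extension of the functional \<open>a \<otimes> \<eta> \<otimes> \<xi> \<mapsto> Re \<langle>\<eta>, \<phi>(a) \<xi>\<rangle>\<close>, which exists by a monotone form of the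
  Hahn-Banach theorem (\<open>positive_extension\<close>); the Riesz representation theorem turns the extended
  functional back into operators.
\<close>

section \<open>The real inner product and the Riesz representation theorem\<close>

text \<open>Working with the real part of the inner product turns forms into real linear functionals;
  \<open>cinner_eq_rinner\<close> recovers the complex inner product, and complex linearity becomes the rule
  \<open>rinner_scaleC_right\<close>.\<close>

definition rinner :: "'a :: complex_hilbert_space \<Rightarrow> 'a \<Rightarrow> real"
  where "rinner x y = Re (cinner x y)"

lemma rinner_commute: "rinner x y = rinner y x"
  unfolding rinner_def by (subst cinner_commute) simp

lemma rinner_self: "rinner x x = (norm x)\<^sup>2"
  by (simp add: rinner_def cinner_self)

lemma rinner_add_right: "rinner x (y + z) = rinner x y + rinner x z"
  by (simp add: rinner_def cinner_add_right)

lemma rinner_add_left: "rinner (x + y) z = rinner x z + rinner y z"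
  by (metis rinner_add_right rinner_commute)

lemma cinner_scaleC_left: "cinner (c *\<^sub>C x) y = cnj c * cinner x y"
  by (subst (1 2) cinner_commute) (simp add: cinner_scaleC_right)

lemma rinner_scaleC_right: "rinner x (c *\<^sub>C y) = rinner (cnj c *\<^sub>C x) y"
  by (simp add: rinner_def cinner_scaleC_right cinner_scaleC_left)

lemma rinner_scaleR_right: "rinner x (r *\<^sub>R y) = r * rinner x y"
  by (simp add: rinner_def scaleC_of_real[symmetric] cinner_scaleC_right)

lemma cinner_eq_rinner: "cinner x y = Complex (rinner x y) (rinner (\<i> *\<^sub>C x) y)"
  by (simp add: rinner_def cinner_scaleC_left complex_eq_iff)

lemma norm_add_square: "(norm (x + y :: 'a :: complex_hilbert_space))\<^sup>2 = (norm x)\<^sup>2 + 2 * rinner x y + (norm y)\<^sup>2"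
  by (simp add: rinner_self[symmetric] rinner_add_right rinner_add_left rinner_commute[of y x])

lemma rinner_le: "rinner x y \<le> norm x * norm y"
proof -
  have "(norm (x + y))\<^sup>2 \<le> (norm x + norm y)\<^sup>2"
    by (simp add: norm_triangle_ineq power_mono)
  then show ?thesis
    by (simp add: norm_add_square power2_sum)
qed

interpretation rinner: bounded_bilinear rinner
proof
  show "rinner (r *\<^sub>R x) y = r *\<^sub>R rinner x y" for r and x y :: 'a
    by (metis rinner_commute rinner_scaleR_right real_scaleR_def)
  then have minus: "rinner (- x) y = - rinner x y" for x y :: 'a
    by (metis scaleR_minus1_left real_scaleR_def mult_minus1)
  have "norm (rinner x y) \<le> norm x * norm y * 1" for x y :: 'a
    using rinner_le[of x y] rinner_le[of "- x" y] by (simp add: minus abs_le_iff)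
  then show "\<exists>K. \<forall>(x :: 'a) y. norm (rinner x y) \<le> norm x * norm y * K"
    by blast
qed (simp_all add: rinner_add_left rinner_add_right rinner_scaleR_right)

lemma abs_rinner_le: "\<bar>rinner x y\<bar> \<le> norm x * norm y"
  using rinner_le[of x y] rinner_le[of "- x" y] by (simp add: rinner.minus_left abs_le_iff)

lemma rinner_eqI:
  assumes "\<And>x. rinner x u = rinner x v"
  shows "u = v"
proof -
  have "rinner (u - v) (u - v) = 0"
    by (simp add: rinner.diff_right assms)
  then show ?thesis
    by (simp add: rinner_self)
qed

lemma linear_coefficient_zero:
  fixes a b :: real
  assumes "\<And>t. 0 \<le> t\<^sup>2 * a + 2 * t * b"
  shows "b = 0"
proof (rule ccontr)
  assume "b \<noteq> 0"
  define s where "s = 1 / (\<bar>a\<bar> + 1)"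
  have s: "s > 0" "s * a < 1"
    by (auto simp: s_def divide_simps)
  have "0 \<le> (- s * b)\<^sup>2 * a + 2 * (- s * b) * b"
    by (rule assms)
  also have "\<dots> = s * b\<^sup>2 * (s * a - 2)"
    by (simp add: power2_eq_square algebra_simps)
  also have "\<dots> < 0"
    using s \<open>b \<noteq> 0\<close> by (intro mult_pos_neg) auto
  finally show False
    by simp
qed

text \<open>The representing vector is the minimiser of \<open>\<parallel>x\<parallel>\<^sup>2 - 2 f(x)\<close>: by the parallelogram law a minimising
  sequence is Cauchy, and at the minimiser the derivative in each direction vanishes.\<close>

theorem riesz_representation:
  fixes f :: "'a :: complex_hilbert_space \<Rightarrow> real"
  assumes "bounded_linear f"
  shows "\<exists>z. \<forall>x. f x = rinner z x"
proof -
  interpret f: bounded_linear f by fact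
  define J where "J x = (norm x)\<^sup>2 - 2 * f x" for x
  obtain K where K: "\<And>x. norm (f x) \<le> norm x * K"
    using f.bounded by blast
  have "- K\<^sup>2 \<le> J x" for x
  proof -
    have "2 * f x \<le> 2 * norm x * K"
      using K[of x] by (simp add: abs_le_iff)
    moreover have "0 \<le> (norm x - K)\<^sup>2"
      by simp
    ultimately show ?thesis
      by (simp add: J_def power2_diff)
  qed
  then have bdd: "bdd_below (range J)"
    by (rule bdd_belowI2)
  define m where "m = Inf (range J)"
  have m: "m \<le> J x" for x
    unfolding m_def by (rule cInf_lower[OF rangeI bdd])
  have "\<exists>x. J x < m + inverse (real (Suc n))" for n
    using cInf_lessD[of "range J" "m + inverse (real (Suc n))"] by (auto simp: m_def)
  then obtain s where s: "\<And>n. J (s n) < m + inverse (real (Suc n))"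
    by metis
  have parallelogram: "(norm (x - y))\<^sup>2 = 2 * J x + 2 * J y - 4 * J ((1/2) *\<^sub>R (x + y))" for x y
  proof -
    have "(norm ((1/2) *\<^sub>R (x + y)))\<^sup>2 = (norm (x + y))\<^sup>2 / 4"
      by (simp add: power_divide del: scaleR_add_right)
    moreover have "f ((1/2) *\<^sub>R (x + y)) = (f x + f y) / 2"
      by (simp add: f.scaleR f.add del: scaleR_add_right)
    moreover have "(norm (x - y))\<^sup>2 = (norm x)\<^sup>2 - 2 * rinner x y + (norm y)\<^sup>2"
      using norm_add_square[of x "- y"] by (simp add: rinner.minus_right)
    ultimately show ?thesis
      using norm_add_square[of x y] unfolding J_def by argo
  qed
  have "Cauchy s"
  proof (rule metric_CauchyI)
    fix e :: real
    assume "0 < e"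
    then obtain N where N: "inverse (real (Suc N)) < e\<^sup>2 / 4"
      using reals_Archimedean[of "e\<^sup>2 / 4"] by auto
    have "dist (s k) (s l) < e" if "k \<ge> N" "l \<ge> N" for k l
    proof -
      have J: "J (s i) < m + e\<^sup>2 / 4" if "i \<ge> N" for i
      proof -
        have "inverse (real (Suc i)) \<le> inverse (real (Suc N))"
          using that by (intro le_imp_inverse_le) auto
        then show ?thesis
          using s[of i] N by linarith
      qed
      have "(norm (s k - s l))\<^sup>2 < e\<^sup>2"
        using J[OF that(1)] J[OF that(2)] m[of "(1/2) *\<^sub>R (s k + s l)"]
        unfolding parallelogram by linarith
      then show ?thesis
        using \<open>0 < e\<close> by (simp add: dist_norm power2_less_imp_less)
    qed
    then show "\<exists>N. \<forall>k\<ge>N. \<forall>l\<ge>N. dist (s k) (s l) < e"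
      by blast
  qed
  then obtain z where z: "s \<longlonglongrightarrow> z"
    using Cauchy_convergent_iff convergent_def by blast
  have "(\<lambda>n. J (s n)) \<longlonglongrightarrow> J z"
    unfolding J_def by (intro tendsto_intros z f.tendsto)
  moreover have "(\<lambda>n. m + inverse (real (Suc n))) \<longlonglongrightarrow> m + 0"
    by (intro tendsto_intros LIMSEQ_inverse_real_of_nat)
  ultimately have "J z \<le> m + 0"
    by (rule LIMSEQ_le) (use s less_imp_le in blast)
  then have min: "J z \<le> J x" for x
    using m[of x] by simp
  have "rinner z x - f x = 0" for x
  proof (rule linear_coefficient_zero)
    fix t
    have "J z \<le> J (z + t *\<^sub>R x)"
      by (rule min)
    then show "0 \<le> t\<^sup>2 * (norm x)\<^sup>2 + 2 * t * (rinner z x - f x)"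
      by (simp add: J_def norm_add_square f.add f.scaleR rinner.scaleR_right power_mult_distrib
        algebra_simps)
  qed
  then show ?thesis
    by (intro exI[of _ z]) simp
qed

text \<open>This is how operators are constructed below: adjoints, and the values of extended maps.\<close>

lemma bilinear_form_operator:
  fixes b :: "'a :: complex_hilbert_space \<Rightarrow> 'a \<Rightarrow> real"
  assumes "bounded_bilinear b"
  shows "\<exists>T :: 'a \<Rightarrow>\<^sub>L 'a. \<forall>x y. rinner y (blinfun_apply T x) = b x y"
proof -
  interpret b: bounded_bilinear b by fact
  have "\<exists>z. \<forall>y. b x y = rinner z y" for x
    by (rule riesz_representation) (rule b.bounded_linear_right)
  then obtain T where T: "\<And>x y. b x y = rinner (T x) y"
    by metis
  then have T': "rinner y (T x) = b x y" for x y
    by (simp add: rinner_commute)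
  obtain K where K: "\<And>x y. norm (b x y) \<le> norm x * norm y * K"
    using b.bounded by blast
  have "bounded_linear T"
  proof
    show "T (x + y) = T x + T y" for x y
      by (rule rinner_eqI) (simp add: T' rinner_add_right b.add_left)
    show "T (r *\<^sub>R x) = r *\<^sub>R T x" for r x
      by (rule rinner_eqI) (simp add: T' rinner.scaleR_right b.scaleR_left)
    have "norm (T x) \<le> norm x * \<bar>K\<bar>" for x
    proof (cases "T x = 0")
      case False
      have "norm (T x) * norm (T x) = b x (T x)"
        by (simp add: T rinner_self power2_eq_square)
      also have "\<dots> \<le> norm x * norm (T x) * \<bar>K\<bar>"
        using K[of x "T x"] mult_left_mono[OF abs_ge_self, of "norm x * norm (T x)" K] by auto
      finally show ?thesis
        using False by (simp add: mult.commute mult.left_commute)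
    qed simp
    then show "\<exists>K. \<forall>x. norm (T x) \<le> norm x * K"
      by blast
  qed
  then show ?thesis
    by (intro exI[of _ "Blinfun T"]) (simp add: bounded_linear_Blinfun_apply T')
qed

lemma bounded_ops_iff: "T \<in> bounded_ops \<longleftrightarrow> (\<forall>c x. blinfun_apply T (c *\<^sub>C x) = c *\<^sub>C blinfun_apply T x)"
  by (simp add: bounded_ops_def)

lemma is_adjoint_iff_rinner:
  assumes "T \<in> bounded_ops"
  shows "is_adjoint S T \<longleftrightarrow> (\<forall>x y. rinner (blinfun_apply S x) y = rinner x (blinfun_apply T y))"
proof
  assume *: "\<forall>x y. rinner (blinfun_apply S x) y = rinner x (blinfun_apply T y)"
  have "rinner (\<i> *\<^sub>C blinfun_apply S x) y = rinner (\<i> *\<^sub>C x) (blinfun_apply T y)" for x y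
    using *[rule_format, of x "cnj \<i> *\<^sub>C y"] assms
      rinner_scaleC_right[of "blinfun_apply S x" "cnj \<i>" y]
      rinner_scaleC_right[of x "cnj \<i>" "blinfun_apply T y"]
    by (simp add: bounded_ops_iff)
  with * show "is_adjoint S T"
    by (simp add: is_adjoint_def cinner_eq_rinner)
qed (simp add: is_adjoint_def rinner_def)

lemma adjoint_exists:
  assumes "T \<in> bounded_ops"
  shows "\<exists>S\<in>bounded_ops. is_adjoint S T"
proof -
  have "bounded_bilinear (\<lambda>x y. rinner x (blinfun_apply T y))"
    using rinner.bounded_bilinear_axioms
    by (rule bounded_bilinear.comp) (auto intro: blinfun.bounded_linear_right)
  then obtain S where S: "\<And>x y. rinner y (blinfun_apply S x) = rinner x (blinfun_apply T y)"
    using bilinear_form_operator by blast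
  have "S \<in> bounded_ops"
    unfolding bounded_ops_iff
  proof (intro allI rinner_eqI)
    fix c and x y :: 'a
    have "rinner (c *\<^sub>C x) (blinfun_apply T y) = rinner x (cnj c *\<^sub>C blinfun_apply T y)"
      by (simp add: rinner_scaleC_right)
    then show "rinner y (blinfun_apply S (c *\<^sub>C x)) = rinner y (c *\<^sub>C blinfun_apply S x)"
      using assms by (simp add: S rinner_scaleC_right bounded_ops_iff)
  qed
  then show ?thesis
    using assms S by (auto simp: is_adjoint_iff_rinner rinner_commute)
qed

section \<open>Norms of operator matrices\<close>

definition matrix_apply ::
    "nat \<Rightarrow> (nat \<Rightarrow> nat \<Rightarrow> ('h :: complex_hilbert_space \<Rightarrow>\<^sub>L 'h)) \<Rightarrow> (nat \<Rightarrow> 'h) \<Rightarrow> nat \<Rightarrow> 'h"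
  where "matrix_apply n a \<xi> i = (\<Sum>j<n. blinfun_apply (a i j) (\<xi> j))"

definition vnorm :: "nat \<Rightarrow> (nat \<Rightarrow> 'h :: complex_hilbert_space) \<Rightarrow> real"
  where "vnorm n \<xi> = L2_set (\<lambda>i. norm (\<xi> i)) {..<n}"

lemma op_matrix_norm_eq:
  "op_matrix_norm n a = (SUP \<xi> \<in> {\<xi>. vnorm n \<xi> \<le> 1}. vnorm n (matrix_apply n a \<xi>))"
  by (simp add: op_matrix_norm_def vnorm_def matrix_apply_def)

lemma vnorm_nonneg: "0 \<le> vnorm n \<xi>"
  by (simp add: vnorm_def)

lemma vnorm_square: "(vnorm n \<xi>)\<^sup>2 = (\<Sum>i<n. (norm (\<xi> i))\<^sup>2)"
  by (simp add: vnorm_def L2_set_def sum_nonneg)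

lemma vnorm_scaleR: "vnorm n (\<lambda>i. r *\<^sub>R \<xi> i) = \<bar>r\<bar> * vnorm n \<xi>"
  by (simp add: vnorm_def L2_set_right_distrib)

lemma vnorm_triangle: "vnorm n (\<lambda>i. \<xi> i + \<eta> i) \<le> vnorm n \<xi> + vnorm n \<eta>"
proof -
  have "vnorm n (\<lambda>i. \<xi> i + \<eta> i) \<le> L2_set (\<lambda>i. norm (\<xi> i) + norm (\<eta> i)) {..<n}"
    unfolding vnorm_def by (intro L2_set_mono norm_triangle_ineq norm_ge_zero)
  also have "\<dots> \<le> vnorm n \<xi> + vnorm n \<eta>"
    unfolding vnorm_def by (rule L2_set_triangle_ineq)
  finally show ?thesis .
qed

lemma matrix_apply_scaleR: "matrix_apply n a (\<lambda>j. r *\<^sub>R \<xi> j) = (\<lambda>i. r *\<^sub>R matrix_apply n a \<xi> i)"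
  by (simp add: fun_eq_iff matrix_apply_def blinfun.scaleR_right scaleR_sum_right)

lemma bdd_above_op_matrix_norm:
  "bdd_above ((\<lambda>\<xi>. vnorm n (matrix_apply n a \<xi>)) ` {\<xi>. vnorm n \<xi> \<le> 1})"
proof (rule bdd_aboveI2)
  fix \<xi> :: "nat \<Rightarrow> 'a"
  assume "\<xi> \<in> {\<xi>. vnorm n \<xi> \<le> 1}"
  then have *: "norm (\<xi> j) \<le> 1" if "j < n" for j
    using member_le_L2_set[of "{..<n}" j "\<lambda>j. norm (\<xi> j)"] that by (simp add: vnorm_def)
  have "vnorm n (matrix_apply n a \<xi>) \<le> (\<Sum>i<n. norm (matrix_apply n a \<xi> i))"
    unfolding vnorm_def by (rule L2_set_le_sum) simp
  also have "\<dots> \<le> (\<Sum>i<n. \<Sum>j<n. norm (a i j))"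
  proof (rule sum_mono)
    fix i
    show "norm (matrix_apply n a \<xi> i) \<le> (\<Sum>j<n. norm (a i j))"
      unfolding matrix_apply_def
    proof (rule sum_norm_le)
      fix j assume "j \<in> {..<n}"
      then show "norm (blinfun_apply (a i j) (\<xi> j)) \<le> norm (a i j)"
        using norm_blinfun[of "a i j" "\<xi> j"] mult_left_mono[OF *, of j "norm (a i j)"] by simp
    qed
  qed
  finally show "vnorm n (matrix_apply n a \<xi>) \<le> (\<Sum>i<n. \<Sum>j<n. norm (a i j))" .
qed

lemma op_matrix_norm_nonneg: "0 \<le> op_matrix_norm n a"
proof -
  have "vnorm n (matrix_apply n a (\<lambda>_. 0)) \<le> op_matrix_norm n a"
    unfolding op_matrix_norm_eq
    by (rule cSUP_upper[OF _ bdd_above_op_matrix_norm]) (simp add: vnorm_def L2_set_def)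
  then show ?thesis
    using vnorm_nonneg order_trans by blast
qed

lemma op_matrix_norm_bound: "vnorm n (matrix_apply n a \<xi>) \<le> op_matrix_norm n a * vnorm n \<xi>"
proof (cases "vnorm n \<xi> = 0")
  case True
  then have "\<xi> j = 0" if "j < n" for j
    using that by (auto simp: vnorm_def L2_set_eq_0_iff)
  then have "matrix_apply n a \<xi> = (\<lambda>_. 0)"
    by (simp add: matrix_apply_def fun_eq_iff)
  then show ?thesis
    by (simp only: True) (simp add: vnorm_def L2_set_def)
next
  case False
  then have pos: "vnorm n \<xi> > 0"
    using vnorm_nonneg[of n \<xi>] by linarith
  define r where "r = inverse (vnorm n \<xi>)"
  have "vnorm n (matrix_apply n a (\<lambda>j. r *\<^sub>R \<xi> j)) \<le> op_matrix_norm n a"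
    unfolding op_matrix_norm_eq
    by (rule cSUP_upper[OF _ bdd_above_op_matrix_norm]) (use pos in \<open>simp add: vnorm_scaleR r_def\<close>)
  then show ?thesis
    using pos by (simp add: matrix_apply_scaleR vnorm_scaleR r_def field_simps)
qed

lemma op_matrix_norm_leI:
  assumes "0 \<le> c" and "\<And>\<xi>. vnorm n (matrix_apply n a \<xi>) \<le> c * vnorm n \<xi>"
  shows "op_matrix_norm n a \<le> c"
  unfolding op_matrix_norm_eq
proof (rule cSUP_least)
  show "{\<xi> :: nat \<Rightarrow> 'a. vnorm n \<xi> \<le> 1} \<noteq> {}"
    by (auto intro!: exI[of _ "\<lambda>_. 0"] simp: vnorm_def L2_set_def)
  fix \<xi> :: "nat \<Rightarrow> 'a"
  assume "\<xi> \<in> {\<xi>. vnorm n \<xi> \<le> 1}"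
  then have "c * vnorm n \<xi> \<le> c"
    using assms(1) mult_left_le[of "vnorm n \<xi>" c] by simp
  then show "vnorm n (matrix_apply n a \<xi>) \<le> c"
    using assms(2) order_trans by blast
qed

lemma op_matrix_norm_cong:
  assumes "\<And>i j. i < n \<Longrightarrow> j < n \<Longrightarrow> a i j = b i j"
  shows "op_matrix_norm n a = op_matrix_norm n b"
proof -
  have "vnorm n (matrix_apply n a \<xi>) = vnorm n (matrix_apply n b \<xi>)" for \<xi>
    unfolding vnorm_def matrix_apply_def
    by (rule L2_set_cong) (use assms in \<open>auto intro!: arg_cong[where f = norm] sum.cong\<close>)
  then show ?thesis
    by (simp add: op_matrix_norm_eq)
qed

lemma op_matrix_norm_triangle:
  "op_matrix_norm n (\<lambda>i j. a i j + b i j) \<le> op_matrix_norm n a + op_matrix_norm n b"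
proof (rule op_matrix_norm_leI)
  fix \<xi>
  have "matrix_apply n (\<lambda>i j. a i j + b i j) \<xi> = (\<lambda>i. matrix_apply n a \<xi> i + matrix_apply n b \<xi> i)"
    by (simp add: fun_eq_iff matrix_apply_def blinfun.add_left sum.distrib)
  then have "vnorm n (matrix_apply n (\<lambda>i j. a i j + b i j) \<xi>)
      \<le> vnorm n (matrix_apply n a \<xi>) + vnorm n (matrix_apply n b \<xi>)"
    by (simp add: vnorm_triangle)
  also have "\<dots> \<le> op_matrix_norm n a * vnorm n \<xi> + op_matrix_norm n b * vnorm n \<xi>"
    by (intro add_mono op_matrix_norm_bound)
  finally show "vnorm n (matrix_apply n (\<lambda>i j. a i j + b i j) \<xi>)
      \<le> (op_matrix_norm n a + op_matrix_norm n b) * vnorm n \<xi>"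
    by (simp add: distrib_right)
qed (simp add: op_matrix_norm_nonneg add_nonneg_nonneg)

lemma op_matrix_norm_scaleR:
  "op_matrix_norm n (\<lambda>i j. r *\<^sub>R a i j) \<le> \<bar>r\<bar> * op_matrix_norm n a"
proof (rule op_matrix_norm_leI)
  fix \<xi>
  have "matrix_apply n (\<lambda>i j. r *\<^sub>R a i j) \<xi> = (\<lambda>i. r *\<^sub>R matrix_apply n a \<xi> i)"
    by (simp add: fun_eq_iff matrix_apply_def blinfun.scaleR_left scaleR_sum_right)
  then show "vnorm n (matrix_apply n (\<lambda>i j. r *\<^sub>R a i j) \<xi>) \<le> \<bar>r\<bar> * op_matrix_norm n a * vnorm n \<xi>"
    using mult_left_mono[OF op_matrix_norm_bound[of n a \<xi>] abs_ge_zero[of r]]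
    by (simp add: vnorm_scaleR mult.assoc)
qed (intro mult_nonneg_nonneg abs_ge_zero op_matrix_norm_nonneg)

lemma op_matrix_norm_1_eq_0:
  assumes "op_matrix_norm 1 (\<lambda>_ _. T) = 0"
  shows "T = 0"
proof (rule blinfun_eqI)
  fix x
  show "blinfun_apply T x = blinfun_apply 0 x"
    using op_matrix_norm_bound[of 1 "\<lambda>_ _. T" "\<lambda>_. x"] assms
    by (simp add: vnorm_def matrix_apply_def lessThan_Suc)
qed

section \<open>Extension of positive functionals\<close>

definition sublinear_on :: "(real \<Rightarrow> 'v \<Rightarrow> 'v) \<Rightarrow> 'v :: ab_group_add set \<Rightarrow> ('v \<Rightarrow> real) \<Rightarrow> bool"
  where "sublinear_on sc V p \<longleftrightarrow>
    (\<forall>x\<in>V. \<forall>y\<in>V. p (x + y) \<le> p x + p y) \<and> (\<forall>r>0. \<forall>x\<in>V. p (sc r x) = r * p x)"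

lemma cInf_approx:
  fixes A :: "real set"
  assumes "A \<noteq> {}" and "0 < e"
  obtains x where "x \<in> A" "x < Inf A + e"
  using cInf_lessD[of A "Inf A + e"] assms by auto

text \<open>Zorn's lemma is applied to sublinear functionals ordered downwards; this is the lower bound of
  a chain. Comparability in the chain is what makes the infimum subadditive.\<close>

lemma sublinear_chain_Inf:
  assumes V: "\<And>x y. x \<in> V \<Longrightarrow> y \<in> V \<Longrightarrow> x + y \<in> V" "\<And>r x. x \<in> V \<Longrightarrow> sc r x \<in> V"
    and C: "C \<noteq> {}" "\<And>q. q \<in> C \<Longrightarrow> sublinear_on sc V q"
    and chain: "\<And>q q'. q \<in> C \<Longrightarrow> q' \<in> C \<Longrightarrow> (\<forall>x\<in>V. q x \<le> q' x) \<or> (\<forall>x\<in>V. q' x \<le> q x)"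
    and bdd: "\<And>x. x \<in> V \<Longrightarrow> bdd_below ((\<lambda>q. q x) ` C)"
  shows "sublinear_on sc V (\<lambda>x. INF q\<in>C. q x)"
  unfolding sublinear_on_def
proof (intro conjI ballI allI impI)
  fix x y assume xy: "x \<in> V" "y \<in> V"
  show "(INF q\<in>C. q (x + y)) \<le> (INF q\<in>C. q x) + (INF q\<in>C. q y)"
  proof (rule field_le_epsilon)
    fix e :: real assume "0 < e"
    obtain q where q: "q \<in> C" "q x < (INF q\<in>C. q x) + e / 2"
      using cInf_approx[of "(\<lambda>q. q x) ` C" "e / 2"] C(1) \<open>0 < e\<close> by auto
    obtain q' where q': "q' \<in> C" "q' y < (INF q\<in>C. q y) + e / 2"
      using cInf_approx[of "(\<lambda>q. q y) ` C" "e / 2"] C(1) \<open>0 < e\<close> by auto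
    obtain r where r: "r \<in> C" "r x \<le> q x" "r y \<le> q' y"
      using chain[OF q(1) q'(1)] q(1) q'(1) xy by auto
    have "(INF q\<in>C. q (x + y)) \<le> r (x + y)"
      by (rule cINF_lower[OF bdd r(1)]) (simp add: V xy)
    also have "\<dots> \<le> r x + r y"
      using C(2)[OF r(1)] xy by (simp add: sublinear_on_def)
    finally show "(INF q\<in>C. q (x + y)) \<le> (INF q\<in>C. q x) + (INF q\<in>C. q y) + e"
      using r q q' by linarith
  qed
next
  fix r :: real and x assume r: "0 < r" and x: "x \<in> V"
  have eq: "(\<lambda>q. q (sc r x)) ` C = (\<lambda>t. r * t) ` (\<lambda>q. q x) ` C"
    unfolding image_image by (rule image_cong) (use C(2) r x in \<open>auto simp: sublinear_on_def\<close>)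
  show "(INF q\<in>C. q (sc r x)) = r * (INF q\<in>C. q x)"
    unfolding eq
  proof (rule continuous_at_Inf_mono[symmetric])
    show "mono ((*) r)"
      using r by (auto intro!: monoI mult_left_mono)
    show "continuous (at_right (INF q\<in>C. q x)) ((*) r)"
      by (intro continuous_intros)
  qed (use C(1) bdd[OF x] in auto)
qed

text \<open>A minimal sublinear functional is linear, since otherwise it could be lowered in one direction.
  Hence it suffices to take a minimal one below \<open>p\<close>.\<close>

lemma hahn_banach:
  fixes sc :: "real \<Rightarrow> 'v \<Rightarrow> 'v :: ab_group_add"
  assumes vs: "vector_space sc" and sub: "module.subspace sc V" and p: "sublinear_on sc V p"
  shows "\<exists>F. (\<forall>x\<in>V. \<forall>y\<in>V. F (x + y) = F x + F y) \<and> (\<forall>r. \<forall>x\<in>V. F (sc r x) = r * F x)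
    \<and> (\<forall>x\<in>V. F x \<le> p x)"
proof -
  interpret vector_space sc by fact
  note V = subspace_add[OF sub] subspace_scale[OF sub] subspace_0[OF sub] subspace_neg[OF sub]
  \<comment> \<open>Functionals on \<open>V\<close> are normalised to vanish off \<open>V\<close>, so that the order is antisymmetric.\<close>
  define S where "S = {q. sublinear_on sc V q \<and> (\<forall>x\<in>V. q x \<le> p x) \<and> (\<forall>x. x \<notin> V \<longrightarrow> q x = 0)}"
  have zero: "q 0 = 0" if "q \<in> S" for q
  proof -
    have "\<forall>r>0. \<forall>x\<in>V. q (sc r x) = r * q x"
      using that unfolding S_def sublinear_on_def by blast
    from this[rule_format, of 2 0] V(3) show ?thesis
      by simp
  qed
  have lower: "- p (- x) \<le> q x" if "q \<in> S" "x \<in> V" for q x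
  proof -
    have "q (x + - x) \<le> q x + q (- x)"
      using that V(4)[OF that(2)] unfolding S_def sublinear_on_def by blast
    moreover have "q (- x) \<le> p (- x)"
      using that V(4)[OF that(2)] by (simp add: S_def)
    ultimately show ?thesis
      using zero[OF that(1)] by simp
  qed
  let ?P = "\<lambda>q q'. \<forall>x\<in>V. q' x \<le> (q x :: real)"
  have "\<exists>m\<in>S. \<forall>q\<in>S. ?P m q \<longrightarrow> q = m"
  proof (rule predicate_Zorn)
    show "partial_order_on S (relation_of ?P S)"
    proof (rule partial_order_on_relation_ofI)
      show "a = b" if "a \<in> S" "b \<in> S" "?P a b" "?P b a" for a b
      proof
        show "a x = b x" for x
          using that by (cases "x \<in> V") (auto simp: S_def intro: order_antisym)
      qed
    qed (auto intro: order_trans)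
    fix C assume C: "C \<in> Chains (relation_of ?P S)"
    then have CS: "q \<in> S" if "q \<in> C" for q
      using that by (auto simp: Chains_def relation_of_def)
    show "\<exists>u\<in>S. \<forall>q\<in>C. ?P q u"
    proof (cases "C = {}")
      case True
      have "(\<lambda>x. if x \<in> V then p x else 0) \<in> S"
        using p V(1,2) by (simp add: S_def sublinear_on_def)
      then show ?thesis
        using True by blast
    next
      case False
      have bdd: "bdd_below ((\<lambda>q. q x) ` C)" if "x \<in> V" for x
        by (rule bdd_belowI2[of _ "- p (- x)"]) (rule lower[OF CS that])
      obtain q0 where q0: "q0 \<in> C"
        using False by blast
      have "sublinear_on sc V (\<lambda>x. INF q\<in>C. q x)"
      proof (rule sublinear_chain_Inf[OF V(1,2) False _ _ bdd])
        show "(\<forall>x\<in>V. q x \<le> q' x) \<or> (\<forall>x\<in>V. q' x \<le> q x)" if "q \<in> C" "q' \<in> C" for q q'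
          using C that by (auto simp: Chains_def relation_of_def)
      qed (use CS in \<open>auto simp: S_def\<close>)
      moreover have "(INF q\<in>C. q x) \<le> p x" if "x \<in> V" for x
        using cINF_lower[OF bdd[OF that] q0] CS[OF q0] that by (force simp: S_def)
      moreover have "(INF q\<in>C. q x) = 0" if "x \<notin> V" for x
      proof -
        have "(\<lambda>q. q x) ` C = {0}"
          using CS that False by (force simp: S_def)
        then show ?thesis
          by simp
      qed
      ultimately have "(\<lambda>x. INF q\<in>C. q x) \<in> S"
        by (simp add: S_def)
      then show ?thesis
        using cINF_lower[OF bdd] by (intro bexI[of _ "\<lambda>x. INF q\<in>C. q x"]) auto
    qed
  qed
  then obtain m where m: "m \<in> S" and min: "\<And>q. q \<in> S \<Longrightarrow> (\<forall>x\<in>V. q x \<le> m x) \<Longrightarrow> q = m"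
    by auto
  have m_add: "m (x + y) \<le> m x + m y" if "x \<in> V" "y \<in> V" for x y
    using m that by (simp add: S_def sublinear_on_def)
  have m_scale: "m (sc r x) = r * m x" if "r \<ge> 0" "x \<in> V" for r x
    using m that zero[OF m] by (cases "r = 0") (auto simp: S_def sublinear_on_def)
  have m_p: "m x \<le> p x" if "x \<in> V" for x
    using m that by (simp add: S_def)
  have super: "m x + m y \<le> m (x + y)" if x: "x \<in> V" and y: "y \<in> V" for x y
  proof -
    \<comment> \<open>The largest sublinear functional below \<open>m\<close> with value at most \<open>- m y\<close> at \<open>- y\<close>.\<close>
    define A where "A x = {m (x + sc t y) - t * m y | t. t \<ge> 0}" for x
    define q where "q x = (if x \<in> V then Inf (A x) else 0)" for x
    have A_lower: "- m (- x) \<le> a" if a: "a \<in> A x" and x: "x \<in> V" for a x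
    proof -
      obtain t where t: "t \<ge> 0" "a = m (x + sc t y) - t * m y"
        using a by (auto simp: A_def)
      have "t * m y = m ((x + sc t y) + - x)"
        using m_scale[OF t(1) y] by simp
      also have "\<dots> \<le> m (x + sc t y) + m (- x)"
        by (intro m_add V x y)
      finally show ?thesis
        using t by simp
    qed
    have bdd: "bdd_below (A x)" if "x \<in> V" for x
      by (rule bdd_belowI[of _ "- m (- x)"]) (rule A_lower[OF _ that])
    have q_le: "q x \<le> m (x + sc t y) - t * m y" if "x \<in> V" "t \<ge> 0" for x t
    proof -
      have "m (x + sc t y) - t * m y \<in> A x"
        using that(2) by (auto simp: A_def)
      from cInf_lower[OF this bdd[OF that(1)]] show ?thesis
        using that(1) by (simp add: q_def)
    qed
    have approx: "\<exists>t\<ge>0. m (x + sc t y) - t * m y < q x + e" if "x \<in> V" "0 < e" for x e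
    proof -
      have "A x \<noteq> {}"
        by (auto simp: A_def)
      then obtain a where "a \<in> A x" "a < Inf (A x) + e"
        using cInf_approx \<open>0 < e\<close> by blast
      then show ?thesis
        using that by (auto simp: A_def q_def)
    qed
    have q_m: "q x \<le> m x" if "x \<in> V" for x
      using q_le[OF that, of 0] by simp
    have q_add: "q (u + v) \<le> q u + q v" if uv: "u \<in> V" "v \<in> V" for u v
    proof (rule field_le_epsilon)
      fix e :: real assume "0 < e"
      obtain s where s: "s \<ge> 0" "m (u + sc s y) - s * m y < q u + e / 2"
        using approx[OF uv(1), of "e / 2"] \<open>0 < e\<close> by auto
      obtain t where t: "t \<ge> 0" "m (v + sc t y) - t * m y < q v + e / 2"
        using approx[OF uv(2), of "e / 2"] \<open>0 < e\<close> by auto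
      have "q (u + v) \<le> m (u + v + sc (s + t) y) - (s + t) * m y"
        by (rule q_le) (use V uv s t in auto)
      also have "u + v + sc (s + t) y = (u + sc s y) + (v + sc t y)"
        by (simp add: scale_left_distrib algebra_simps)
      also have "m \<dots> \<le> m (u + sc s y) + m (v + sc t y)"
        by (intro m_add V uv y)
      finally show "q (u + v) \<le> q u + q v + e"
        using s t by (simp add: distrib_right)
    qed
    have q_scale_le: "q (sc r u) \<le> r * q u" if r: "r > 0" and u: "u \<in> V" for r u
    proof (rule field_le_epsilon)
      fix e :: real assume "0 < e"
      obtain s where s: "s \<ge> 0" "m (u + sc s y) - s * m y < q u + e / r"
        using approx[OF u, of "e / r"] \<open>0 < e\<close> r by auto
      have "q (sc r u) \<le> m (sc r u + sc (r * s) y) - (r * s) * m y"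
        by (rule q_le) (use V u r s in auto)
      also have "sc r u + sc (r * s) y = sc r (u + sc s y)"
        by (simp add: scale_right_distrib)
      also have "m \<dots> = r * m (u + sc s y)"
        using r V u y by (simp add: m_scale)
      finally have "q (sc r u) \<le> r * (m (u + sc s y) - s * m y)"
        by (simp add: algebra_simps)
      also have "\<dots> \<le> r * (q u + e / r)"
        using s r by (intro mult_left_mono) auto
      also have "\<dots> = r * q u + e"
        using r by (simp add: distrib_left)
      finally show "q (sc r u) \<le> r * q u + e" .
    qed
    have "q (sc r u) = r * q u" if r: "r > 0" and u: "u \<in> V" for r u
    proof (rule order_antisym[OF q_scale_le[OF r u]])
      have "q (sc (1 / r) (sc r u)) \<le> (1 / r) * q (sc r u)"
        by (rule q_scale_le) (use r u V in auto)
      then show "r * q u \<le> q (sc r u)"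
        using r by (simp add: field_simps)
    qed
    moreover have "q u \<le> p u" if "u \<in> V" for u
      using q_m[OF that] m_p[OF that] by simp
    ultimately have "q \<in> S"
      using q_add by (simp add: S_def sublinear_on_def q_def)
    then have "q = m"
      using min q_m by blast
    then show ?thesis
      using q_le[OF x, of 1] by simp
  qed
  have add: "m (x + y) = m x + m y" if "x \<in> V" "y \<in> V" for x y
    using super[OF that] m_add[OF that] by simp
  have neg: "m (- x) = - m x" if "x \<in> V" for x
    using add[OF that V(4)[OF that]] zero[OF m] by simp
  have "m (sc r x) = r * m x" if "x \<in> V" for r x
  proof (cases "r \<ge> 0")
    case False
    then have "m (- sc (- r) x) = r * m x"
      using that V by (simp add: neg m_scale del: scale_minus_left)
    then show ?thesis
      by simp
  qed (simp add: m_scale that)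
  then show ?thesis
    using add m_p by blast
qed

text \<open>A positive functional on a space \<open>W\<close> of functions is given as a linear relation \<open>R\<close>, the pairs
  \<open>(w, r)\<close> meaning that \<open>w\<close> has value \<open>r\<close>; positivity of \<open>R\<close> makes the value unique. In this
  form a functional can be given by its values on formal sums of generators. The functional extends to all functions dominated by \<open>W\<close>.\<close>

definition dominated :: "(('g \<Rightarrow> real) \<times> real) set \<Rightarrow> ('g \<Rightarrow> real) set"
  where "dominated R = {v. \<exists>w r. (w, r) \<in> R \<and> (\<forall>g. \<bar>v g\<bar> \<le> w g)}"

lemma dominated_add:
  assumes R_add: "\<And>w r w' r'. (w, r) \<in> R \<Longrightarrow> (w', r') \<in> R \<Longrightarrow> (\<lambda>g. w g + w' g, r + r') \<in> R"
    and "u \<in> dominated R" "v \<in> dominated R"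
  shows "(\<lambda>g. u g + v g) \<in> dominated R"
proof -
  obtain w r w' r' where w: "(w, r) \<in> R" "\<forall>g. \<bar>u g\<bar> \<le> w g" "(w', r') \<in> R" "\<forall>g. \<bar>v g\<bar> \<le> w' g"
    using assms(2,3) by (auto simp: dominated_def)
  have "\<bar>u g + v g\<bar> \<le> w g + w' g" for g
    using w(2,4)[rule_format, of g] by linarith
  then show ?thesis
    using R_add[OF w(1,3)] by (auto simp: dominated_def)
qed

lemma dominated_scale:
  assumes R_scale: "\<And>w r t. (w, r) \<in> R \<Longrightarrow> (\<lambda>g. t * w g, t * r) \<in> R"
    and "v \<in> dominated R"
  shows "(\<lambda>g. t * v g) \<in> dominated R"
proof -
  obtain w r where w: "(w, r) \<in> R" "\<forall>g. \<bar>v g\<bar> \<le> w g"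
    using assms(2) by (auto simp: dominated_def)
  have "\<bar>t * v g\<bar> \<le> \<bar>t\<bar> * w g" for g
    using w(2) by (simp add: abs_mult mult_left_mono)
  then show ?thesis
    using R_scale[OF w(1), of "\<bar>t\<bar>"] by (auto simp: dominated_def)
qed

text \<open>The functional sending \<open>v\<close> to the infimum of the values of the \<open>w \<ge> v\<close> in \<open>W\<close> is sublinear,
  and domination keeps it finite. A linear functional below it agrees with the given one on \<open>W\<close>, and
  it is positive because the sublinear functional is at most \<open>0\<close> at every \<open>v \<le> 0\<close>.\<close>

lemma positive_extension:
  fixes R :: "(('g \<Rightarrow> real) \<times> real) set"
  assumes R_ne: "(w0, r0) \<in> R"
    and R_add: "\<And>w r w' r'. (w, r) \<in> R \<Longrightarrow> (w', r') \<in> R \<Longrightarrow> (\<lambda>g. w g + w' g, r + r') \<in> R"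
    and R_scale: "\<And>w r t. (w, r) \<in> R \<Longrightarrow> (\<lambda>g. t * w g, t * r) \<in> R"
    and R_pos: "\<And>w r. (w, r) \<in> R \<Longrightarrow> (\<And>g. 0 \<le> w g) \<Longrightarrow> 0 \<le> r"
  obtains F where "\<And>u v. u \<in> dominated R \<Longrightarrow> v \<in> dominated R \<Longrightarrow> F (\<lambda>g. u g + v g) = F u + F v"
    and "\<And>t v. v \<in> dominated R \<Longrightarrow> F (\<lambda>g. t * v g) = t * F v"
    and "\<And>v. v \<in> dominated R \<Longrightarrow> \<forall>g. 0 \<le> v g \<Longrightarrow> 0 \<le> F v"
    and "\<And>w r. (w, r) \<in> R \<Longrightarrow> w \<in> dominated R \<Longrightarrow> F w = r"
proof -
  let ?sc = "\<lambda>t (v :: 'g \<Rightarrow> real) g. t * v g"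
  define V where "V = dominated R"
  note V_def' = V_def[unfolded dominated_def]
  have vs: "vector_space ?sc"
    by unfold_locales (auto simp: fun_eq_iff algebra_simps)
  interpret vector_space ?sc by fact
  have R_zero: "(\<lambda>_. 0, 0) \<in> R"
    using R_scale[OF R_ne, of 0] by simp
  have sub: "subspace V"
  proof (rule subspaceI)
    show "0 \<in> V"
      using R_zero by (force simp: V_def')
    show "u + v \<in> V" if "u \<in> V" "v \<in> V" for u v
      using that unfolding V_def plus_fun_def by (intro dominated_add R_add)
    show "?sc t v \<in> V" if "v \<in> V" for t v
      using that unfolding V_def by (intro dominated_scale R_scale)
  qed
  define P where "P v = {r. \<exists>w. (w, r) \<in> R \<and> (\<forall>g. v g \<le> w g)}" for v
  define p where "p v = Inf (P v)" for v
  have R_mono: "r \<le> r'" if "(w, r) \<in> R" "(w', r') \<in> R" "\<And>g. w g \<le> w' g" for w r w' r'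
    using R_pos[OF R_add[OF that(2) R_scale[OF that(1), of "- 1"]]] that(3) by simp
  have P_ne: "P v \<noteq> {}" if "v \<in> V" for v
  proof -
    obtain w r where "(w, r) \<in> R" "\<And>g. \<bar>v g\<bar> \<le> w g"
      using \<open>v \<in> V\<close> by (auto simp: V_def')
    then have "r \<in> P v"
      unfolding P_def using abs_le_D1 by blast
    then show ?thesis
      by blast
  qed
  have bdd: "bdd_below (P v)" if "v \<in> V" for v
  proof -
    obtain w r where w: "(w, r) \<in> R" "\<And>g. \<bar>v g\<bar> \<le> w g"
      using \<open>v \<in> V\<close> by (auto simp: V_def')
    have "- r \<le> r'" if r': "r' \<in> P v" for r'
    proof -
      obtain w' where w': "(w', r') \<in> R" "\<And>g. v g \<le> w' g"
        using r' by (auto simp: P_def)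
      have "- w g \<le> w' g" for g
        using w(2)[of g] w'(2)[of g] by linarith
      then show ?thesis
        using R_mono[OF R_scale[OF w(1), of "- 1"] w'(1)] by simp
    qed
    then show ?thesis
      by (rule bdd_belowI)
  qed
  have p_le: "p v \<le> r" if "v \<in> V" "(w, r) \<in> R" "\<And>g. v g \<le> w g" for v w r
    unfolding p_def by (rule cInf_lower[OF _ bdd]) (use that in \<open>auto simp: P_def\<close>)
  have p_approx: "\<exists>w r. (w, r) \<in> R \<and> (\<forall>g. v g \<le> w g) \<and> r < p v + e" if v: "v \<in> V" and e: "0 < e" for v e
  proof -
    obtain r where "r \<in> P v" "r < p v + e"
      using cInf_approx[OF P_ne[OF v] e] unfolding p_def by blast
    then show ?thesis
      by (auto simp: P_def)
  qed
  have p_scale: "p (?sc t v) \<le> t * p v" if t: "0 < t" and v: "v \<in> V" for t v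
  proof (rule field_le_epsilon)
    fix e :: real assume "0 < e"
    obtain w r where w: "(w, r) \<in> R" "\<forall>g. v g \<le> w g" "r < p v + e / t"
      using p_approx[OF v, of "e / t"] \<open>0 < e\<close> t by auto
    have "p (?sc t v) \<le> t * r"
      by (rule p_le[OF subspace_scale[OF sub v] R_scale[OF w(1)]])
        (use w(2) t in \<open>simp add: mult_left_mono\<close>)
    also have "\<dots> \<le> t * (p v + e / t)"
      using w t by simp
    also have "\<dots> = t * p v + e"
      using t by (simp add: distrib_left)
    finally show "p (?sc t v) \<le> t * p v + e" .
  qed
  have "sublinear_on ?sc V p"
    unfolding sublinear_on_def
  proof (intro conjI ballI allI impI)
    fix u v assume uv: "u \<in> V" "v \<in> V"
    show "p (u + v) \<le> p u + p v"
    proof (rule field_le_epsilon)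
      fix e :: real assume "0 < e"
      obtain w r where w: "(w, r) \<in> R" "\<forall>g. u g \<le> w g" "r < p u + e / 2"
        using p_approx[OF uv(1), of "e / 2"] \<open>0 < e\<close> by auto
      obtain w' r' where w': "(w', r') \<in> R" "\<forall>g. v g \<le> w' g" "r' < p v + e / 2"
        using p_approx[OF uv(2), of "e / 2"] \<open>0 < e\<close> by auto
      have "p (u + v) \<le> r + r'"
        by (rule p_le[OF subspace_add[OF sub uv] R_add[OF w(1) w'(1)]])
          (use w w' in \<open>simp add: add_mono\<close>)
      then show "p (u + v) \<le> p u + p v + e"
        using w w' by simp
    qed
  next
    fix t :: real and v assume t: "0 < t" and v: "v \<in> V"
    have "p (?sc (1 / t) (?sc t v)) \<le> (1 / t) * p (?sc t v)"
      by (rule p_scale) (use t subspace_scale[OF sub v] in auto)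
    then have "t * p v \<le> p (?sc t v)"
      using t by (simp add: field_simps)
    then show "p (?sc t v) = t * p v"
      using p_scale[OF t v] by simp
  qed
  from hahn_banach[OF vs sub this] obtain F where F_add: "\<forall>x\<in>V. \<forall>y\<in>V. F (x + y) = F x + F y"
    and F_scale: "\<forall>r. \<forall>x\<in>V. F (?sc r x) = r * F x" and F_p: "\<forall>x\<in>V. F x \<le> p x"
    by blast
  have neg: "?sc (- 1) v \<in> V" "F (?sc (- 1) v) = - F v" if "v \<in> V" for v
    using F_scale[rule_format, OF that, of "- 1"] subspace_scale[OF sub that, of "- 1"] by auto
  show thesis
  proof (rule that)
    show "F (\<lambda>g. u g + v g) = F u + F v" if "u \<in> dominated R" "v \<in> dominated R" for u v
      using F_add that by (simp add: plus_fun_def V_def)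
    show "F (\<lambda>g. t * v g) = t * F v" if "v \<in> dominated R" for t v
      using F_scale that by (simp add: V_def)
    show "0 \<le> F v" if "v \<in> dominated R" and pos: "\<forall>g. 0 \<le> v g" for v
    proof -
      have v: "v \<in> V"
        using that(1) by (simp add: V_def)
      have "p (?sc (- 1) v) \<le> 0"
        by (rule p_le[OF neg(1)[OF v] R_zero]) (simp add: pos)
      then show ?thesis
        using F_p neg[OF v] by fastforce
    qed
    show "F w = r" if "(w, r) \<in> R" "w \<in> dominated R" for w r
    proof -
      have w: "(w, r) \<in> R" "w \<in> V"
        using that by (auto simp: V_def)
      have "F w \<le> r"
        using F_p w p_le[OF w(2,1)] order_trans by blast
      moreover have "p (?sc (- 1) w) \<le> - r"
        using p_le[OF neg(1)[OF w(2)] R_scale[OF w(1), of "- 1"]] by simp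
      then have "- F w \<le> - r"
        using F_p neg[OF w(2)] by fastforce
      ultimately show ?thesis
        by simp
    qed
  qed
qed

section \<open>Accretive matrices\<close>

lemma scaleC_op_of_real: "scaleC_op (complex_of_real r) T = r *\<^sub>R T"
  by transfer (simp add: scaleC_of_real fun_eq_iff)

lemma scaleC_op_apply: "blinfun_apply (scaleC_op c T) x = c *\<^sub>C blinfun_apply T x"
  by (simp add: scaleC_op.rep_eq)

lemma concrete_operator_spaceD:
  assumes "concrete_operator_space Z"
  shows "id_blinfun \<in> Z" "0 \<in> Z" "S \<in> Z \<Longrightarrow> T \<in> Z \<Longrightarrow> S + T \<in> Z" "T \<in> Z \<Longrightarrow> scaleC_op c T \<in> Z"
    "T \<in> Z \<Longrightarrow> T \<in> bounded_ops" "T \<in> Z \<Longrightarrow> r *\<^sub>R T \<in> Z" "S \<in> Z \<Longrightarrow> T \<in> Z \<Longrightarrow> S - T \<in> Z"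
proof -
  have Z: "id_blinfun \<in> Z" "cop.subspace Z" "Z \<subseteq> bounded_ops"
    using assms by (auto simp: concrete_operator_space_def)
  note sub = Z(1) cop.subspace_0[OF Z(2)] cop.subspace_add[OF Z(2)] cop.subspace_scale[OF Z(2)]
    cop.subspace_diff[OF Z(2)]
  show "id_blinfun \<in> Z" "0 \<in> Z" "S \<in> Z \<Longrightarrow> T \<in> Z \<Longrightarrow> S + T \<in> Z"
    "T \<in> Z \<Longrightarrow> scaleC_op c T \<in> Z" "S \<in> Z \<Longrightarrow> T \<in> Z \<Longrightarrow> S - T \<in> Z"
    by (fact sub)+
  show "T \<in> Z \<Longrightarrow> T \<in> bounded_ops"
    using Z(3) by blast
  show "T \<in> Z \<Longrightarrow> r *\<^sub>R T \<in> Z"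
    using sub(4)[of T "complex_of_real r"] by (simp add: scaleC_op_of_real)
qed

lemma concrete_operator_space_bounded_ops:
  "concrete_operator_space (bounded_ops :: ('h :: complex_hilbert_space \<Rightarrow>\<^sub>L 'h) set)"
  unfolding concrete_operator_space_def cop.subspace_def
  by (auto simp: bounded_ops_iff scaleC_op_apply blinfun.add_left scaleC_add_right scaleC_scaleC
      mult.commute) (metis scaleC_scaleC scaleC_of_real scaleR_zero_left mult_zero_right of_real_0)

lemma ucc_op_space_iff:
  "ucc (op_space Z) (op_space W) \<phi> \<longleftrightarrow>
    (\<forall>S\<in>Z. \<phi> S \<in> W) \<and> (\<forall>S\<in>Z. \<forall>T\<in>Z. \<phi> (S + T) = \<phi> S + \<phi> T)
    \<and> (\<forall>c. \<forall>T\<in>Z. \<phi> (scaleC_op c T) = scaleC_op c (\<phi> T))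
    \<and> (\<forall>n\<ge>1. \<forall>a. (\<forall>i<n. \<forall>j<n. a i j \<in> Z) \<longrightarrow>
        op_matrix_norm n (\<lambda>i j. \<phi> (a i j)) \<le> op_matrix_norm n a)
    \<and> \<phi> id_blinfun = id_blinfun"
  by (auto simp: ucc_def completely_contractive_def linear_map_def op_space_def matrices_def)

text \<open>Matrices with positive real part. No adjoints are mentioned, so that the notion makes sense in
  spaces of operators that are not closed under adjoints.\<close>

definition accretive :: "nat \<Rightarrow> (nat \<Rightarrow> nat \<Rightarrow> ('h :: complex_hilbert_space \<Rightarrow>\<^sub>L 'h)) \<Rightarrow> bool"
  where "accretive n a \<longleftrightarrow> (\<forall>x. 0 \<le> (\<Sum>i<n. rinner (x i) (matrix_apply n a x i)))"

lemma vnorm_diff_square: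
  "(vnorm n (\<lambda>i. x i - t *\<^sub>R y i))\<^sup>2
    = (vnorm n x)\<^sup>2 - 2 * t * (\<Sum>i<n. rinner (x i) (y i)) + t\<^sup>2 * (vnorm n y)\<^sup>2"
proof -
  have "(norm (x i - t *\<^sub>R y i))\<^sup>2 = (norm (x i))\<^sup>2 - 2 * t * rinner (x i) (y i) + t\<^sup>2 * (norm (y i))\<^sup>2" for i
    using norm_add_square[of "x i" "- t *\<^sub>R y i"] by (simp add: rinner.scaleR_right power_mult_distrib rinner.minus_right)
  then show ?thesis
    by (simp add: vnorm_square sum.distrib sum_subtractf sum_distrib_left)
qed

lemma vnorm_cong: "(\<And>i. i < n \<Longrightarrow> x i = y i) \<Longrightarrow> vnorm n x = vnorm n y"
  unfolding vnorm_def by (rule L2_set_cong) auto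

text \<open>The matrix \<open>1 - t a\<close>, through which accretivity is read off from norms.\<close>

definition identity_minus ::
    "real \<Rightarrow> (nat \<Rightarrow> nat \<Rightarrow> ('h :: complex_hilbert_space \<Rightarrow>\<^sub>L 'h)) \<Rightarrow> nat \<Rightarrow> nat \<Rightarrow> ('h \<Rightarrow>\<^sub>L 'h)"
  where "identity_minus t a i j = (if i = j then id_blinfun else 0) - t *\<^sub>R a i j"

lemma vnorm_identity_minus:
  "(vnorm n (matrix_apply n (identity_minus t a) x))\<^sup>2
    = (vnorm n x)\<^sup>2 - 2 * t * (\<Sum>i<n. rinner (x i) (matrix_apply n a x i))
      + t\<^sup>2 * (vnorm n (matrix_apply n a x))\<^sup>2"
proof -
  have "matrix_apply n (identity_minus t a) x i = x i - t *\<^sub>R matrix_apply n a x i" if "i < n" for i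
  proof -
    have "blinfun_apply (identity_minus t a i j) (x j)
        = (if i = j then x j else 0) - t *\<^sub>R blinfun_apply (a i j) (x j)" for j
      by (simp add: identity_minus_def blinfun.diff_left blinfun.scaleR_left)
    then show ?thesis
      using that by (simp add: matrix_apply_def scaleR_sum_right sum_subtractf)
  qed
  then have "vnorm n (matrix_apply n (identity_minus t a) x)
      = vnorm n (\<lambda>i. x i - t *\<^sub>R matrix_apply n a x i)"
    by (rule vnorm_cong)
  then show ?thesis
    by (simp add: vnorm_diff_square)
qed

text \<open>If \<open>a\<close> is accretive then \<open>\<parallel>1 - t a\<parallel>\<^sup>2 \<le> 1 + t\<^sup>2 \<parallel>a\<parallel>\<^sup>2\<close> for \<open>t > 0\<close>. A unital complete contraction
  preserves this inequality, and letting \<open>t\<close> tend to \<open>0\<close> recovers accretivity of the image.\<close>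

lemma ucc_accretive:
  fixes a :: "nat \<Rightarrow> nat \<Rightarrow> ('k :: complex_hilbert_space \<Rightarrow>\<^sub>L 'k)"
    and \<phi> :: "('k \<Rightarrow>\<^sub>L 'k) \<Rightarrow> ('h :: complex_hilbert_space \<Rightarrow>\<^sub>L 'h)"
  assumes Z: "concrete_operator_space Z" and \<phi>: "ucc (op_space Z) (op_space W) \<phi>"
    and a: "\<And>i j. i < n \<Longrightarrow> j < n \<Longrightarrow> a i j \<in> Z" and acc: "accretive n a"
  shows "accretive n (\<lambda>i j. \<phi> (a i j))"
proof (cases "n = 0")
  case False
  note Z = concrete_operator_spaceD[OF Z]
  define M where "M = op_matrix_norm n a"
  have M: "0 \<le> M"
    by (simp add: M_def op_matrix_norm_nonneg)
  have small: "op_matrix_norm n (identity_minus t a) \<le> sqrt (1 + t\<^sup>2 * M\<^sup>2)" if "0 < t" for t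
  proof (rule op_matrix_norm_leI)
    fix x :: "nat \<Rightarrow> 'k"
    have "(vnorm n (matrix_apply n a x))\<^sup>2 \<le> (M * vnorm n x)\<^sup>2"
      unfolding M_def by (intro power_mono op_matrix_norm_bound vnorm_nonneg)
    then have "t\<^sup>2 * (vnorm n (matrix_apply n a x))\<^sup>2 \<le> t\<^sup>2 * (M\<^sup>2 * (vnorm n x)\<^sup>2)"
      by (intro mult_left_mono) (auto simp: power_mult_distrib)
    moreover have "0 \<le> 2 * t * (\<Sum>i<n. rinner (x i) (matrix_apply n a x i))"
      using acc \<open>0 < t\<close> unfolding accretive_def by (intro mult_nonneg_nonneg) auto
    ultimately have "(vnorm n (matrix_apply n (identity_minus t a) x))\<^sup>2 \<le> (1 + t\<^sup>2 * M\<^sup>2) * (vnorm n x)\<^sup>2"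
      unfolding vnorm_identity_minus by (simp add: algebra_simps)
    from real_sqrt_le_mono[OF this] show "vnorm n (matrix_apply n (identity_minus t a) x)
        \<le> sqrt (1 + t\<^sup>2 * M\<^sup>2) * vnorm n x"
      by (simp add: real_sqrt_mult vnorm_nonneg)
  qed simp
  have \<phi>_diff: "\<phi> (identity_minus t a i j) = identity_minus t (\<lambda>i j. \<phi> (a i j)) i j"
    if "i < n" "j < n" for t i j
  proof -
    have e: "(if i = j then id_blinfun else 0) \<in> Z" "- t *\<^sub>R a i j \<in> Z"
      using Z(1,2) Z(6)[OF a[OF that], of "- t"] by auto
    have "\<phi> 0 = 0"
      using \<phi> Z(2) unfolding ucc_op_space_iff by (metis cop.scale_zero_left)
    then have "\<phi> (if i = j then id_blinfun else 0) = (if i = j then id_blinfun else 0)"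
      using \<phi> by (simp add: ucc_op_space_iff)
    moreover have "\<phi> (- t *\<^sub>R a i j) = - t *\<^sub>R \<phi> (a i j)"
      using \<phi> a[OF that] unfolding ucc_op_space_iff scaleC_op_of_real[symmetric] by blast
    moreover have "\<phi> ((if i = j then id_blinfun else 0) + - t *\<^sub>R a i j)
        = \<phi> (if i = j then id_blinfun else 0) + \<phi> (- t *\<^sub>R a i j)"
      using \<phi> e unfolding ucc_op_space_iff by blast
    ultimately show ?thesis
      by (simp add: identity_minus_def)
  qed
  have "op_matrix_norm n (identity_minus t (\<lambda>i j. \<phi> (a i j))) \<le> sqrt (1 + t\<^sup>2 * M\<^sup>2)" if "0 < t" for t
  proof -
    have "\<forall>i<n. \<forall>j<n. identity_minus t a i j \<in> Z"
      using Z(1,2,6,7) a unfolding identity_minus_def by (metis (full_types))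
    then have "op_matrix_norm n (\<lambda>i j. \<phi> (identity_minus t a i j)) \<le> op_matrix_norm n (identity_minus t a)"
      using \<phi> False unfolding ucc_op_space_iff by simp
    also have "op_matrix_norm n (\<lambda>i j. \<phi> (identity_minus t a i j))
        = op_matrix_norm n (identity_minus t (\<lambda>i j. \<phi> (a i j)))"
      by (rule op_matrix_norm_cong) (rule \<phi>_diff)
    finally show ?thesis
      using small[OF that] by simp
  qed note image_small = this
  show ?thesis
    unfolding accretive_def
  proof (intro allI)
    fix x :: "nat \<Rightarrow> 'h"
    define r where "r = (\<Sum>i<n. rinner (x i) (matrix_apply n (\<lambda>i j. \<phi> (a i j)) x i))"
    define C where "C = M\<^sup>2 * (vnorm n x)\<^sup>2"
    have C: "0 \<le> C"
      by (simp add: C_def)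
    have pos: "0 \<le> t * C + 2 * r" if t: "0 < t" for t
    proof -
      let ?b = "identity_minus t (\<lambda>i j. \<phi> (a i j))"
      have "vnorm n (matrix_apply n ?b x) \<le> sqrt (1 + t\<^sup>2 * M\<^sup>2) * vnorm n x"
        using op_matrix_norm_bound[of n ?b x] mult_right_mono[OF image_small[OF t] vnorm_nonneg[of n x]]
        by linarith
      from power_mono[OF this vnorm_nonneg, of 2]
      have "(vnorm n (matrix_apply n ?b x))\<^sup>2 \<le> (1 + t\<^sup>2 * M\<^sup>2) * (vnorm n x)\<^sup>2"
        by (simp add: power_mult_distrib)
      moreover have "0 \<le> t\<^sup>2 * (vnorm n (matrix_apply n (\<lambda>i j. \<phi> (a i j)) x))\<^sup>2"
        by simp
      ultimately have "0 \<le> t * (t * C + 2 * r)"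
        unfolding vnorm_identity_minus r_def[symmetric] C_def
        by (simp add: algebra_simps power2_eq_square)
      then show ?thesis
        using t by (simp add: zero_le_mult_iff)
    qed
    show "0 \<le> r"
    proof (rule ccontr)
      assume "\<not> 0 \<le> r"
      define t where "t = - r / (C + 1)"
      have t: "0 < t" "t * (C + 1) = - r"
        using \<open>\<not> 0 \<le> r\<close> C by (auto simp: t_def divide_neg_pos)
      with pos[OF t(1)] \<open>\<not> 0 \<le> r\<close> show False
        by (simp add: distrib_left)
    qed
  qed
qed (simp add: accretive_def)

section \<open>Finite rank compressions\<close>

lemma cinner_diff_right: "cinner x (y - z) = cinner x y - cinner x z"
  using cinner_add_right[of x "y - z" z] by simp

lemma cinner_sum_right: "cinner x (\<Sum>p\<in>A. f p) = (\<Sum>p\<in>A. cinner x (f p))"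
proof -
  have "cinner x 0 = 0"
    using cinner_add_right[of x 0 0] by simp
  then show ?thesis
    by (induction A rule: infinite_finite_induct) (simp_all add: cinner_add_right)
qed

text \<open>Gram-Schmidt orthogonalisation.\<close>

lemma orthonormal_expansion:
  fixes S :: "'h :: complex_hilbert_space set"
  assumes "finite S"
  shows "\<exists>(m :: nat) e. (\<forall>p<m. \<forall>q<m. cinner (e p) (e q) = of_bool (p = q))
    \<and> (\<forall>v\<in>S. v = (\<Sum>p<m. cinner (e p) v *\<^sub>C e p))"
  using assms
proof (induction S rule: finite_induct)
  case empty
  show ?case
    by (rule exI[of _ "0 :: nat"]) simp
next
  case (insert v S)
  from insert.IH obtain m :: nat and e where
    orthonormal: "\<forall>p<m. \<forall>q<m. cinner (e p) (e q) = of_bool (p = q)"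
    and S: "\<forall>u\<in>S. u = (\<Sum>p<m. cinner (e p) u *\<^sub>C e p)"
    by (elim exE conjE)
  note e = orthonormal[rule_format]
  define r where "r = v - (\<Sum>p<m. cinner (e p) v *\<^sub>C e p)"
  have e_r: "cinner (e p) r = 0" if "p < m" for p
    using that by (simp add: r_def cinner_diff_right cinner_sum_right cinner_scaleC_right e of_bool_def if_distrib cong: if_cong)
  then have r_e: "cinner r (e p) = 0" if "p < m" for p
    using that by (subst cinner_commute) simp
  have combination: "cinner r (\<Sum>p<m. c p *\<^sub>C e p) = 0" for c
    by (simp add: cinner_sum_right cinner_scaleC_right r_e)
  show ?case
  proof (cases "r = 0")
    case True
    then have "v = (\<Sum>p<m. cinner (e p) v *\<^sub>C e p)"
      by (simp add: r_def)
    then show ?thesis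
      using orthonormal S by (intro exI[of _ m] exI[of _ e]) blast
  next
    case False
    define c where "c = complex_of_real (1 / norm r)"
    define e' where "e' = e(m := c *\<^sub>C r)"
    have rr: "cinner r r = (norm r)\<^sup>2"
      by (rule cinner_self)
    have norm: "c * (c * (norm r)\<^sup>2) = 1" "cnj c = c"
      using False by (auto simp: c_def power2_eq_square)
    have sum_e': "(\<Sum>p<Suc m. cinner (e' p) u *\<^sub>C e' p)
        = (\<Sum>p<m. cinner (e p) u *\<^sub>C e p) + (c * cinner r u) *\<^sub>C c *\<^sub>C r" for u
      by (simp add: e'_def cinner_scaleC_left norm(2))
    have "cinner (e' p) (e' q) = of_bool (p = q)" if "p < Suc m" "q < Suc m" for p q
      using that norm e e_r r_e
      by (auto simp: e'_def less_Suc_eq cinner_scaleC_left cinner_scaleC_right rr mult.left_commute)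
    then have "\<forall>p<Suc m. \<forall>q<Suc m. cinner (e' p) (e' q) = of_bool (p = q)"
      by blast
    moreover have "u = (\<Sum>p<Suc m. cinner (e' p) u *\<^sub>C e' p)" if "u \<in> insert v S" for u
    proof (cases "u = v")
      case True
      have v: "v = (\<Sum>p<m. cinner (e p) v *\<^sub>C e p) + r"
        by (simp add: r_def)
      have "cinner r v = (norm r)\<^sup>2"
        by (subst v) (simp add: cinner_add_right combination rr)
      then show ?thesis
        unfolding sum_e' True scaleC_scaleC using norm(1) v
        by (simp add: mult.commute mult.left_commute scaleC_of_real[of 1, simplified])
    next
      case False
      then have u: "u = (\<Sum>p<m. cinner (e p) u *\<^sub>C e p)"
        using S that by simp
      then have "cinner r u = 0"
        using combination by metis
      then show ?thesis
        unfolding sum_e' using u scaleC_of_real[of 0] by (simp add: scaleC_scaleC)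
    qed
    then have "\<forall>u\<in>insert v S. u = (\<Sum>p<Suc m. cinner (e' p) u *\<^sub>C e' p)"
      by blast
    ultimately show ?thesis
      by (intro exI[of _ "Suc m"] exI[of _ e'] conjI)
  qed
qed

text \<open>A list of pairs \<open>(e, x)\<close> encodes the finite rank operator sending \<open>v\<close> to the sum of the
  \<open>\<langle>e, v\<rangle> x\<close>. Every value of the list type gives a complex linear map, so functions of such operators are
  functions on a type.\<close>

definition finite_rank :: "('h :: complex_hilbert_space \<times> 'k :: complex_hilbert_space) list \<Rightarrow> 'h \<Rightarrow> 'k"
  where "finite_rank g v = (\<Sum>(e, x)\<leftarrow>g. cinner e v *\<^sub>C x)"

lemma finite_rank_add: "finite_rank g (u + v) = finite_rank g u + finite_rank g v"
  unfolding finite_rank_def by (induction g) (auto simp: cinner_add_right scaleC_add_left)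

lemma scaleC_zero_right: "c *\<^sub>C (0 :: 'h :: complex_hilbert_space) = 0"
  by (metis add_cancel_right_right scaleC_add_right)

lemma finite_rank_scaleC: "finite_rank g (c *\<^sub>C v) = c *\<^sub>C finite_rank g v"
  unfolding finite_rank_def
  by (induction g) (auto simp: cinner_scaleC_right scaleC_add_right scaleC_scaleC scaleC_zero_right)

lemma finite_rank_scaleR: "finite_rank g (r *\<^sub>R v) = r *\<^sub>R finite_rank g v"
  by (simp add: scaleC_of_real[symmetric] finite_rank_scaleC)

text \<open>The elementary tensor \<open>a \<otimes> \<eta> \<otimes> \<xi>\<close> is represented by the function \<open>G \<mapsto> Re \<langle>G \<eta>, a G \<xi>\<rangle>\<close> of the
  finite rank operators \<open>G: H \<rightarrow> K\<close>. The tensor relations then hold as equalities of functions, and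
  positivity of tensors is the pointwise order. A list of triples \<open>(a, \<eta>, \<xi>)\<close> stands for a sum
  of elementary tensors, and \<open>pairing\<close> is the functional on such sums that a map \<open>\<phi>\<close> induces.\<close>

definition compressed_form :: "('k :: complex_hilbert_space \<Rightarrow>\<^sub>L 'k) \<Rightarrow> 'h :: complex_hilbert_space \<Rightarrow> 'h
    \<Rightarrow> ('h \<times> 'k) list \<Rightarrow> real"
  where "compressed_form a \<eta> \<xi> g = rinner (finite_rank g \<eta>) (blinfun_apply a (finite_rank g \<xi>))"

definition compressed_sum :: "(('k :: complex_hilbert_space \<Rightarrow>\<^sub>L 'k) \<times> 'h :: complex_hilbert_space \<times> 'h) list
    \<Rightarrow> ('h \<times> 'k) list \<Rightarrow> real"
  where "compressed_sum l g = (\<Sum>(a, \<eta>, \<xi>)\<leftarrow>l. compressed_form a \<eta> \<xi> g)"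

definition pairing :: "('b \<Rightarrow> ('h :: complex_hilbert_space \<Rightarrow>\<^sub>L 'h)) \<Rightarrow> ('b \<times> 'h \<times> 'h) list \<Rightarrow> real"
  where "pairing \<phi> l = (\<Sum>(a, \<eta>, \<xi>)\<leftarrow>l. rinner \<eta> (blinfun_apply (\<phi> a) \<xi>))"

text \<open>The matrix of coefficients of a sum of elementary tensors with respect to the vectors \<open>e\<^sub>p\<close>,
  with \<open>\<phi>\<close> applied to the entries.\<close>

definition gram_matrix ::
    "(nat \<Rightarrow> 'h :: complex_hilbert_space) \<Rightarrow> ('b \<times> 'h \<times> 'h) list
      \<Rightarrow> ('b \<Rightarrow> ('k :: complex_hilbert_space \<Rightarrow>\<^sub>L 'k)) \<Rightarrow> nat \<Rightarrow> nat \<Rightarrow> ('k \<Rightarrow>\<^sub>L 'k)"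
  where "gram_matrix e l \<phi> p q
    = (\<Sum>(a, \<eta>, \<xi>)\<leftarrow>l. scaleC_op (cnj (cinner (e p) \<eta>) * cinner (e q) \<xi>) (\<phi> a))"

lemma scaleC_sum_right: "c *\<^sub>C (\<Sum>p\<in>A. f p) = (\<Sum>p\<in>A. c *\<^sub>C f p)"
  by (induction A rule: infinite_finite_induct) (simp_all add: scaleC_add_right scaleC_zero_right)

lemma quadratic_form_gram_matrix:
  fixes x :: "nat \<Rightarrow> 'k :: complex_hilbert_space"
  assumes "\<And>a \<eta> \<xi>. (a, \<eta>, \<xi>) \<in> set l \<Longrightarrow> \<phi> a \<in> bounded_ops"
  shows "(\<Sum>p<m. rinner (x p) (matrix_apply m (gram_matrix e l \<phi>) x p))
    = (\<Sum>(a, \<eta>, \<xi>)\<leftarrow>l. rinner (\<Sum>p<m. cinner (e p) \<eta> *\<^sub>C x p)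
        (blinfun_apply (\<phi> a) (\<Sum>q<m. cinner (e q) \<xi> *\<^sub>C x q)))"
  using assms
proof (induction l)
  case Nil
  then show ?case
    by (simp add: gram_matrix_def matrix_apply_def rinner.zero_right)
next
  case (Cons t l)
  obtain a \<eta> \<xi> where t: "t = (a, \<eta>, \<xi>)"
    by (cases t) auto
  have a: "\<phi> a \<in> bounded_ops"
    using Cons.prems[of a \<eta> \<xi>] t by simp
  have "matrix_apply m (gram_matrix e (t # l) \<phi>) x p
      = cnj (cinner (e p) \<eta>) *\<^sub>C blinfun_apply (\<phi> a) (\<Sum>q<m. cinner (e q) \<xi> *\<^sub>C x q)
        + matrix_apply m (gram_matrix e l \<phi>) x p" for p
    using a by (simp add: matrix_apply_def gram_matrix_def t blinfun.add_left sum.distrib scaleC_op_apply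
        blinfun.sum_right scaleC_sum_right bounded_ops_iff scaleC_scaleC)
  then have "(\<Sum>p<m. rinner (x p) (matrix_apply m (gram_matrix e (t # l) \<phi>) x p))
      = rinner (\<Sum>p<m. cinner (e p) \<eta> *\<^sub>C x p) (blinfun_apply (\<phi> a) (\<Sum>q<m. cinner (e q) \<xi> *\<^sub>C x q))
        + (\<Sum>p<m. rinner (x p) (matrix_apply m (gram_matrix e l \<phi>) x p))"
    by (simp add: rinner_add_right sum.distrib rinner_scaleC_right rinner.sum_left)
  also have "(\<Sum>p<m. rinner (x p) (matrix_apply m (gram_matrix e l \<phi>) x p))
      = (\<Sum>(a, \<eta>, \<xi>)\<leftarrow>l. rinner (\<Sum>p<m. cinner (e p) \<eta> *\<^sub>C x p)
        (blinfun_apply (\<phi> a) (\<Sum>q<m. cinner (e q) \<xi> *\<^sub>C x q)))"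
    by (rule Cons.IH) (use Cons.prems in auto)
  finally show ?case
    by (simp add: t)
qed

lemma gram_matrix_in:
  assumes Z: "concrete_operator_space Z" and \<phi>: "ucc (op_space Z) (op_space W) \<phi>"
    and "\<And>a \<eta> \<xi>. (a, \<eta>, \<xi>) \<in> set l \<Longrightarrow> a \<in> Z"
  shows "gram_matrix e l (\<lambda>a. a) p q \<in> Z \<and> \<phi> (gram_matrix e l (\<lambda>a. a) p q) = gram_matrix e l \<phi> p q"
  using assms(3)
proof (induction l)
  case Nil
  have "\<phi> 0 = 0"
    using \<phi> concrete_operator_spaceD(2)[OF Z] unfolding ucc_op_space_iff by (metis cop.scale_zero_left)
  then show ?case
    using concrete_operator_spaceD(2)[OF Z] by (simp add: gram_matrix_def)
next
  case (Cons t l)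
  obtain a \<eta> \<xi> where t: "t = (a, \<eta>, \<xi>)"
    by (cases t) auto
  have "a \<in> Z"
    using Cons.prems[of a \<eta> \<xi>] t by simp
  moreover have "gram_matrix e l (\<lambda>a. a) p q \<in> Z
      \<and> \<phi> (gram_matrix e l (\<lambda>a. a) p q) = gram_matrix e l \<phi> p q"
    by (rule Cons.IH) (use Cons.prems in auto)
  ultimately show ?case
    using \<phi> concrete_operator_spaceD(3,4)[OF Z]
    unfolding gram_matrix_def ucc_op_space_iff t by simp
qed

text \<open>Here positivity of the functional is reduced to \<open>ucc_accretive\<close>. Expand all vectors in an orthonormal
  system \<open>e\<close>. Testing with the operators \<open>G\<close> that send \<open>e\<^sub>p\<close> to an arbitrary vector \<open>x\<^sub>p\<close> shows
  that the coefficient matrix is accretive. Hence so is its image under \<open>\<phi>\<close>, and the pairing is the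
  quadratic form of that image at the vectors \<open>e\<^sub>p\<close> themselves.\<close>

lemma pairing_nonneg:
  fixes \<phi> :: "('k :: complex_hilbert_space \<Rightarrow>\<^sub>L 'k) \<Rightarrow> ('h :: complex_hilbert_space \<Rightarrow>\<^sub>L 'h)"
  assumes Z: "concrete_operator_space Z" and \<phi>: "ucc (op_space Z) (op_space bounded_ops) \<phi>"
    and l: "\<And>a \<eta> \<xi>. (a, \<eta>, \<xi>) \<in> set l \<Longrightarrow> a \<in> Z" and pos: "\<And>g. 0 \<le> compressed_sum l g"
  shows "0 \<le> pairing \<phi> l"
proof -
  have "finite ((fst \<circ> snd) ` set l \<union> (snd \<circ> snd) ` set l)"
    by simp
  from orthonormal_expansion[OF this] obtain m :: nat and e where
    e: "\<forall>v \<in> (fst \<circ> snd) ` set l \<union> (snd \<circ> snd) ` set l. v = (\<Sum>p<m. cinner (e p) v *\<^sub>C e p)"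
    by blast
  have expand: "\<eta> = (\<Sum>p<m. cinner (e p) \<eta> *\<^sub>C e p)" "\<xi> = (\<Sum>p<m. cinner (e p) \<xi> *\<^sub>C e p)"
    if "(a, \<eta>, \<xi>) \<in> set l" for a \<eta> \<xi>
    using e that by force+
  have bounded: "a \<in> bounded_ops" "\<phi> a \<in> bounded_ops" if "(a, \<eta>, \<xi>) \<in> set l" for a \<eta> \<xi>
    using l[OF that] \<phi> concrete_operator_spaceD(5)[OF Z] by (auto simp: ucc_op_space_iff)
  have gram: "gram_matrix e l (\<lambda>a. a) p q \<in> Z"
    "\<phi> (gram_matrix e l (\<lambda>a. a) p q) = gram_matrix e l \<phi> p q" for p q
    using gram_matrix_in[OF Z \<phi>, of l e p q] l by blast+
  have "accretive m (gram_matrix e l (\<lambda>a. a))"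
    unfolding accretive_def
  proof
    fix x :: "nat \<Rightarrow> 'k"
    define g where "g = map (\<lambda>p. (e p, x p)) [0..<m]"
    have g: "finite_rank g v = (\<Sum>p<m. cinner (e p) v *\<^sub>C x p)" for v
      by (simp add: g_def finite_rank_def o_def interv_sum_list_conv_sum_set_nat atLeast0LessThan)
    have "compressed_sum l g = (\<Sum>p<m. rinner (x p) (matrix_apply m (gram_matrix e l (\<lambda>a. a)) x p))"
      by (subst quadratic_form_gram_matrix) (use bounded in \<open>auto simp: compressed_sum_def compressed_form_def g\<close>)
    then show "0 \<le> (\<Sum>p<m. rinner (x p) (matrix_apply m (gram_matrix e l (\<lambda>a. a)) x p))"
      using pos[of g] by simp
  qed
  then have "accretive m (\<lambda>p q. \<phi> (gram_matrix e l (\<lambda>a. a) p q))"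
    by (rule ucc_accretive[OF Z \<phi> gram(1)])
  moreover have "(\<lambda>p q. \<phi> (gram_matrix e l (\<lambda>a. a) p q)) = gram_matrix e l \<phi>"
    by (simp add: gram(2))
  ultimately have "0 \<le> (\<Sum>p<m. rinner (e p) (matrix_apply m (gram_matrix e l \<phi>) e p))"
    unfolding accretive_def by simp
  also have "\<dots> = (\<Sum>(a, \<eta>, \<xi>)\<leftarrow>l. rinner (\<Sum>p<m. cinner (e p) \<eta> *\<^sub>C e p)
        (blinfun_apply (\<phi> a) (\<Sum>q<m. cinner (e q) \<xi> *\<^sub>C e q)))"
    by (rule quadratic_form_gram_matrix) (use bounded in auto)
  also have "\<dots> = pairing \<phi> l"
    unfolding pairing_def
    by (intro arg_cong[where f = sum_list] map_cong refl) (use expand in \<open>auto simp flip: expand\<close>)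
  finally show ?thesis .
qed


section \<open>Injectivity of the bounded operators\<close>

lemma sum_rinner_le: "(\<Sum>i<n. rinner (x i) (y i)) \<le> vnorm n x * vnorm n y"
proof -
  have "(\<Sum>i<n. rinner (x i) (y i)) \<le> (\<Sum>i<n. \<bar>norm (x i)\<bar> * \<bar>norm (y i)\<bar>)"
    by (intro sum_mono) (simp add: rinner_le)
  also have "\<dots> \<le> vnorm n x * vnorm n y"
    unfolding vnorm_def by (rule L2_set_mult_ineq)
  finally show ?thesis .
qed

text \<open>Positivity of the functional on the tensors with entries in \<open>Z\<close> gives a positive extension \<open>F\<close> to
  all tensors. The form \<open>F(a \<otimes> \<eta> \<otimes> \<xi>)\<close> is real bilinear in \<open>\<eta>\<close> and \<open>\<xi>\<close> and defines the operator \<open>\<psi>(a)\<close>; moving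
  complex scalars between \<open>a\<close>, \<open>\<eta>\<close> and \<open>\<xi>\<close> does not change the tensor, so everything is complex linear.
  The contraction estimate comes from positivity at a single tensor, the step \<open>key\<close> below.\<close>

theorem ucc_extension:
  fixes \<phi> :: "('k :: complex_hilbert_space \<Rightarrow>\<^sub>L 'k) \<Rightarrow> ('h :: complex_hilbert_space \<Rightarrow>\<^sub>L 'h)"
  assumes Z: "concrete_operator_space Z" and \<phi>: "ucc (op_space Z) (op_space bounded_ops) \<phi>"
  shows "\<exists>\<psi>. ucc (op_space bounded_ops) (op_space bounded_ops) \<psi> \<and> (\<forall>z\<in>Z. \<psi> z = \<phi> z)"
proof -
  note Zs = concrete_operator_spaceD[OF Z]
  define R where "R = {(compressed_sum l, pairing \<phi> l) | l. \<forall>(a, \<eta>, \<xi>)\<in>set l. a \<in> Z}"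
  have R_I: "(compressed_sum l, pairing \<phi> l) \<in> R" if "\<forall>(a, \<eta>, \<xi>)\<in>set l. a \<in> Z" for l
    using that by (auto simp: R_def)
  have R_add: "(\<lambda>g. w g + w' g, r + r') \<in> R" if wr: "(w, r) \<in> R" "(w', r') \<in> R" for w w' r r'
  proof -
    obtain l l' where l: "\<forall>(a, \<eta>, \<xi>)\<in>set l. a \<in> Z" "w = compressed_sum l" "r = pairing \<phi> l"
      and l': "\<forall>(a, \<eta>, \<xi>)\<in>set l'. a \<in> Z" "w' = compressed_sum l'" "r' = pairing \<phi> l'"
      using wr by (auto simp: R_def)
    have "(compressed_sum (l @ l'), pairing \<phi> (l @ l')) \<in> R"
      using l(1) l'(1) by (intro R_I) auto
    moreover have "compressed_sum (l @ l') = (\<lambda>g. w g + w' g)"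
      by (simp add: fun_eq_iff compressed_sum_def l l')
    ultimately show ?thesis
      by (simp add: pairing_def l l')
  qed
  have R_scale: "(\<lambda>g. t * w g, t * r) \<in> R" if wr: "(w, r) \<in> R" for w r t
  proof -
    obtain l where l: "\<forall>(a, \<eta>, \<xi>)\<in>set l. a \<in> Z" "w = compressed_sum l" "r = pairing \<phi> l"
      using wr by (auto simp: R_def)
    let ?l = "map (\<lambda>(a, \<eta>, \<xi>). (t *\<^sub>R a, \<eta>, \<xi>)) l"
    have \<phi>_scaleR: "\<phi> (t *\<^sub>R a) = t *\<^sub>R \<phi> a" if "a \<in> Z" for a
      using \<phi> that unfolding ucc_op_space_iff scaleC_op_of_real[symmetric] by blast
    have "(compressed_sum ?l, pairing \<phi> ?l) \<in> R"
      using l(1) Zs(6) by (intro R_I) auto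
    moreover have "compressed_sum ?l = (\<lambda>g. t * w g)"
      unfolding l(2) compressed_sum_def
      by (rule ext, induction l) (auto simp: compressed_form_def blinfun.scaleR_left rinner.scaleR_right distrib_left)
    moreover have "pairing \<phi> ?l = t * r"
      using l(1) unfolding l(3) pairing_def
      by (induction l) (auto simp: blinfun.scaleR_left rinner.scaleR_right distrib_left \<phi>_scaleR)
    ultimately show ?thesis
      by simp
  qed
  have R_pos: "0 \<le> r" if wr: "(w, r) \<in> R" and pos: "\<And>g. 0 \<le> w g" for w r
  proof -
    obtain l where l: "\<forall>(a, \<eta>, \<xi>)\<in>set l. a \<in> Z" "w = compressed_sum l" "r = pairing \<phi> l"
      using wr by (auto simp: R_def)
    have "a \<in> Z" if "(a, \<eta>, \<xi>) \<in> set l" for a \<eta> \<xi>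
      using l(1) that by fast
    then show ?thesis
      using pairing_nonneg[OF Z \<phi>, of l] pos unfolding l by blast
  qed
  let ?V = "dominated R"
  obtain F where F_add: "\<And>u v. u \<in> ?V \<Longrightarrow> v \<in> ?V \<Longrightarrow> F (\<lambda>g. u g + v g) = F u + F v"
    and F_scale: "\<And>t v. v \<in> ?V \<Longrightarrow> F (\<lambda>g. t * v g) = t * F v"
    and F_pos: "\<And>v. v \<in> ?V \<Longrightarrow> (\<forall>g. 0 \<le> v g) \<Longrightarrow> 0 \<le> F v"
    and F_R: "\<And>w r. (w, r) \<in> R \<Longrightarrow> w \<in> ?V \<Longrightarrow> F w = r"
  proof (rule positive_extension)
    show "(compressed_sum [], pairing \<phi> []) \<in> R"
      by (rule R_I) simp
    show "(\<lambda>g. w g + w' g, r + r') \<in> R" if "(w, r) \<in> R" "(w', r') \<in> R" for w w' r r'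
      using that by (rule R_add)
    show "(\<lambda>g. t * w g, t * r) \<in> R" if "(w, r) \<in> R" for w r t
      using that by (rule R_scale)
    show "0 \<le> r" if "(w, r) \<in> R" "\<And>g. 0 \<le> w g" for w r
      using that by (rule R_pos)
  qed (rule that)
  have V_add: "(\<lambda>g. u g + v g) \<in> ?V" if "u \<in> ?V" "v \<in> ?V" for u v
    using that by (intro dominated_add R_add)
  have V_scale: "(\<lambda>g. t * v g) \<in> ?V" if "v \<in> ?V" for t v
    using that by (intro dominated_scale R_scale)
  \<comment> \<open>The dominating tensor uses the unit of \<open>Z\<close> and the inequality \<open>2 s t \<le> s\<^sup>2 + t\<^sup>2\<close>.\<close>
  have compressed_form_V: "compressed_form a \<eta> \<xi> \<in> ?V" for a \<eta> \<xi>
  proof -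
    let ?c = "(norm a / 2) *\<^sub>R id_blinfun"
    let ?l = "[(?c, \<eta>, \<eta>), (?c, \<xi>, \<xi>)]"
    have "\<bar>compressed_form a \<eta> \<xi> g\<bar> \<le> compressed_sum ?l g" for g
    proof -
      let ?x = "norm (finite_rank g \<eta>)" and ?y = "norm (finite_rank g \<xi>)"
      have "\<bar>compressed_form a \<eta> \<xi> g\<bar> \<le> ?x * (norm a * ?y)"
        unfolding compressed_form_def
        by (rule order_trans[OF abs_rinner_le]) (simp add: mult_left_mono norm_blinfun)
      also have "\<dots> \<le> norm a / 2 * (?x\<^sup>2 + ?y\<^sup>2)"
        using mult_left_mono[OF sum_squares_bound[of ?x ?y] norm_ge_zero[of a]]
        by (simp add: field_simps)
      also have "\<dots> = compressed_sum ?l g"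
        by (simp add: compressed_sum_def compressed_form_def blinfun.scaleR_left rinner.scaleR_right rinner_self distrib_left)
      finally show ?thesis .
    qed
    moreover have "(compressed_sum ?l, pairing \<phi> ?l) \<in> R"
      using Zs(1,6) by (intro R_I) auto
    ultimately show ?thesis
      unfolding dominated_def by blast
  qed
  define B where "B a \<eta> \<xi> = F (compressed_form a \<eta> \<xi>)" for a \<eta> \<xi>
  have B_Z: "B a \<eta> \<xi> = rinner \<eta> (blinfun_apply (\<phi> a) \<xi>)" if "a \<in> Z" for a \<eta> \<xi>
  proof -
    have "compressed_sum [(a, \<eta>, \<xi>)] = compressed_form a \<eta> \<xi>"
      by (simp add: fun_eq_iff compressed_sum_def)
    then have "(compressed_form a \<eta> \<xi>, pairing \<phi> [(a, \<eta>, \<xi>)]) \<in> R"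
      using R_I[of "[(a, \<eta>, \<xi>)]"] that by simp
    from F_R[OF this compressed_form_V] show ?thesis
      by (simp add: B_def pairing_def)
  qed
  have B_add: "B (a + b) \<eta> \<xi> = B a \<eta> \<xi> + B b \<eta> \<xi>" "B a (\<eta> + \<eta>') \<xi> = B a \<eta> \<xi> + B a \<eta>' \<xi>"
    "B a \<eta> (\<xi> + \<xi>') = B a \<eta> \<xi> + B a \<eta> \<xi>'" for a b \<eta> \<eta>' \<xi> \<xi>'
    unfolding B_def F_add[OF compressed_form_V compressed_form_V, symmetric]
    by (auto intro!: arg_cong[where f = F] simp: fun_eq_iff compressed_form_def finite_rank_add rinner_add_left
        rinner_add_right blinfun.add_left blinfun.add_right)
  have B_scaleR: "B a (t *\<^sub>R \<eta>) \<xi> = t * B a \<eta> \<xi>" "B a \<eta> (t *\<^sub>R \<xi>) = t * B a \<eta> \<xi>" for a t \<eta> \<xi>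
    unfolding B_def F_scale[OF compressed_form_V, symmetric]
    by (auto intro!: arg_cong[where f = F] simp: fun_eq_iff compressed_form_def finite_rank_scaleR
        rinner.scaleR_left rinner.scaleR_right blinfun.scaleR_right)
  have B_scaleC_op: "B (scaleC_op c a) \<eta> \<xi> = B a (cnj c *\<^sub>C \<eta>) \<xi>" for c a \<eta> \<xi>
    by (simp add: B_def compressed_form_def[abs_def] scaleC_op_apply finite_rank_scaleC rinner_scaleC_right)
  have B_scaleC: "B a \<eta> (c *\<^sub>C \<xi>) = B a (cnj c *\<^sub>C \<eta>) \<xi>" if "a \<in> bounded_ops" for a c \<eta> \<xi>
    using that by (simp add: B_def compressed_form_def[abs_def] finite_rank_scaleC rinner_scaleC_right bounded_ops_iff)
  have F_sum: "(\<lambda>g. \<Sum>i<n. f i g) \<in> ?V \<and> F (\<lambda>g. \<Sum>i<n. f i g) = (\<Sum>i<n. F (f i))"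
    if f: "\<And>i. f i \<in> ?V" for f :: "nat \<Rightarrow> _" and n
  proof (induction n)
    case 0
    show ?case
      using V_scale[OF f, of 0 0] F_scale[OF f, of 0 0] by simp
  next
    case (Suc n)
    then show ?case
      using V_add[of "\<lambda>g. \<Sum>i<n. f i g" "f n"] F_add[of "\<lambda>g. \<Sum>i<n. f i g" "f n"] f by simp
  qed
  \<comment> \<open>The tensor of the \<open>2n \<times> 2n\<close> matrix with diagonal blocks \<open>\<parallel>a\<parallel>\<close> and off-diagonal blocks \<open>2 a\<close> and
    \<open>0\<close> is positive, so \<open>F\<close> is nonnegative at it.\<close>
  have key: "0 \<le> op_matrix_norm n a * (vnorm n x)\<^sup>2 + op_matrix_norm n a * (vnorm n y)\<^sup>2
      + 2 * (\<Sum>i<n. \<Sum>j<n. B (a i j) (x i) (y j))" for n a x y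
  proof -
    define c where "c = op_matrix_norm n a"
    define v where "v i g = (c * compressed_form id_blinfun (x i) (x i) g + c * compressed_form id_blinfun (y i) (y i) g)
      + 2 * (\<Sum>j<n. compressed_form (a i j) (x i) (y j) g)" for i g
    have v: "v i \<in> ?V" for i
      unfolding v_def using F_sum[of "\<lambda>j. compressed_form (a i j) (x i) (y j)"] compressed_form_V
      by (intro V_add V_scale) auto
    have F_v: "F (v i) = c * (norm (x i))\<^sup>2 + c * (norm (y i))\<^sup>2 + 2 * (\<Sum>j<n. B (a i j) (x i) (y j))" for i
    proof -
      have id: "F (compressed_form id_blinfun z z) = (norm z)\<^sup>2" for z
        using B_Z[OF Zs(1)] \<phi> by (simp add: B_def ucc_op_space_iff rinner_self)
      have s: "(\<lambda>g. \<Sum>j<n. compressed_form (a i j) (x i) (y j) g) \<in> ?V"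
        "F (\<lambda>g. \<Sum>j<n. compressed_form (a i j) (x i) (y j) g) = (\<Sum>j<n. B (a i j) (x i) (y j))"
        using F_sum[of "\<lambda>j. compressed_form (a i j) (x i) (y j)"] compressed_form_V by (auto simp: B_def)
      show ?thesis
        unfolding v_def
        by (subst F_add F_scale; (intro V_add V_scale s compressed_form_V)?)+ (simp add: id s)
    qed
    have "0 \<le> F (\<lambda>g. \<Sum>i<n. v i g)"
    proof (rule F_pos[OF _ allI])
      show "(\<lambda>g. \<Sum>i<n. v i g) \<in> ?V"
        using F_sum[of v] v by blast
      fix g :: "('h \<times> 'k) list"
      let ?x = "\<lambda>i. finite_rank g (x i)" and ?y = "\<lambda>i. finite_rank g (y i)"
      have v_eq: "(\<Sum>i<n. v i g) = c * (vnorm n ?x)\<^sup>2 + c * (vnorm n ?y)\<^sup>2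
          + 2 * (\<Sum>i<n. rinner (?x i) (matrix_apply n a ?y i))"
        by (simp add: v_def compressed_form_def rinner_self vnorm_square sum.distrib sum_distrib_left
            matrix_apply_def rinner.sum_right)
      have "- (\<Sum>i<n. rinner (?x i) (matrix_apply n a ?y i)) \<le> vnorm n (\<lambda>i. - ?x i) * vnorm n (matrix_apply n a ?y)"
        using sum_rinner_le[where n = n and x = "\<lambda>i. - ?x i" and y = "matrix_apply n a ?y"] by (simp add: rinner.minus_left sum_negf)
      also have "\<dots> \<le> vnorm n ?x * (c * vnorm n ?y)"
        using vnorm_scaleR[of n "- 1" ?x] op_matrix_norm_bound[of n a ?y]
        by (simp add: c_def mult_left_mono vnorm_nonneg)
      finally have *: "- (\<Sum>i<n. rinner (?x i) (matrix_apply n a ?y i)) \<le> vnorm n ?x * (c * vnorm n ?y)" .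
      have "0 \<le> c * (vnorm n ?x - vnorm n ?y)\<^sup>2"
        by (simp add: c_def op_matrix_norm_nonneg)
      then have "2 * (vnorm n ?x * (c * vnorm n ?y)) \<le> c * (vnorm n ?x)\<^sup>2 + c * (vnorm n ?y)\<^sup>2"
        by (simp add: power2_diff algebra_simps)
      then show "0 \<le> (\<Sum>i<n. v i g)"
        unfolding v_eq using * by linarith
    qed
    also have "F (\<lambda>g. \<Sum>i<n. v i g) = (\<Sum>i<n. F (v i))"
      using F_sum[of v] v by blast
    also have "\<dots> = c * (vnorm n x)\<^sup>2 + c * (vnorm n y)\<^sup>2 + 2 * (\<Sum>i<n. \<Sum>j<n. B (a i j) (x i) (y j))"
      by (simp add: F_v vnorm_square sum.distrib sum_distrib_left)
    finally show ?thesis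
      by (simp add: c_def)
  qed
  have "bounded_bilinear (\<lambda>\<xi> \<eta>. B a \<eta> \<xi>)" for a
  proof
    define c where "c = op_matrix_norm 1 (\<lambda>_ _. a)"
    have bound: "\<bar>B a \<eta> \<xi>\<bar> \<le> norm \<xi> * norm \<eta> * c" for \<xi> \<eta>
    proof (cases "\<xi> = 0 \<or> \<eta> = 0")
      case True
      then have "B a \<eta> \<xi> = 0"
        using B_scaleR(1)[of a 0 \<eta> \<xi>] B_scaleR(2)[of a \<eta> 0 \<xi>] by auto
      then show ?thesis
        by (simp add: c_def op_matrix_norm_nonneg)
    next
      case False
      have "0 \<le> c + c + 2 * (s * B a \<eta> \<xi> / (norm \<xi> * norm \<eta>))" if "\<bar>s\<bar> = 1" for s
        using key[of 1 "\<lambda>_ _. a" "\<lambda>_. (s / norm \<eta>) *\<^sub>R \<eta>" "\<lambda>_. (1 / norm \<xi>) *\<^sub>R \<xi>"] False that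
        by (simp add: vnorm_square lessThan_Suc B_scaleR c_def)
      from this[of 1] this[of "- 1"] have "\<bar>B a \<eta> \<xi> / (norm \<xi> * norm \<eta>)\<bar> \<le> c"
        by (simp add: abs_le_iff)
      then show ?thesis
        using False by (simp add: abs_divide abs_mult divide_le_eq mult_ac)
    qed
    then show "\<exists>K. \<forall>\<xi> \<eta>. norm (B a \<eta> \<xi>) \<le> norm \<xi> * norm \<eta> * K"
      by (intro exI[of _ c]) simp
  qed (simp_all add: B_add B_scaleR)
  then have "\<exists>T :: 'h \<Rightarrow>\<^sub>L 'h. \<forall>\<xi> \<eta>. rinner \<eta> (blinfun_apply T \<xi>) = B a \<eta> \<xi>" for a
    by (rule bilinear_form_operator)
  then obtain \<psi> :: "('k \<Rightarrow>\<^sub>L 'k) \<Rightarrow> ('h \<Rightarrow>\<^sub>L 'h)" where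
    \<psi>: "\<And>a \<xi> \<eta>. rinner \<eta> (blinfun_apply (\<psi> a) \<xi>) = B a \<eta> \<xi>"
    by metis
  have eqI: "S = T" if "\<And>\<xi> \<eta>. rinner \<eta> (blinfun_apply S \<xi>) = rinner \<eta> (blinfun_apply T \<xi>)"
    for S T :: "'h \<Rightarrow>\<^sub>L 'h"
    by (rule blinfun_eqI, rule rinner_eqI) (rule that)
  have extends: "\<psi> z = \<phi> z" if "z \<in> Z" for z
    by (rule eqI) (simp add: \<psi> B_Z that)
  have contractive: "op_matrix_norm n (\<lambda>i j. \<psi> (a i j)) \<le> op_matrix_norm n a" for n a
  proof (rule op_matrix_norm_leI)
    show c: "0 \<le> op_matrix_norm n a"
      by (rule op_matrix_norm_nonneg)
    fix y
    define z where "z = matrix_apply n (\<lambda>i j. \<psi> (a i j)) y"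
    let ?c = "op_matrix_norm n a"
    \<comment> \<open>Insert \<open>x = - s z\<close> in \<open>key\<close>; the choice \<open>s = 1 / ?c\<close> below is optimal.\<close>
    have "0 \<le> ?c * (s\<^sup>2 * (vnorm n z)\<^sup>2) + ?c * (vnorm n y)\<^sup>2 - 2 * (s * (vnorm n z)\<^sup>2)" for s
    proof -
      have "(\<Sum>i<n. \<Sum>j<n. B (a i j) (- s *\<^sub>R z i) (y j)) = (\<Sum>i<n. rinner (- s *\<^sub>R z i) (z i))"
        by (simp only: z_def matrix_apply_def rinner.sum_right \<psi>)
      also have "\<dots> = - (s * (vnorm n z)\<^sup>2)"
        by (simp add: rinner.scaleR_left rinner.minus_left rinner_self vnorm_square sum_distrib_left sum_negf)
      finally show ?thesis
        using key[of n a "\<lambda>i. - s *\<^sub>R z i" y] vnorm_scaleR[of n "- s" z] by (simp add: power_mult_distrib)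
    qed note * = this
    have "(vnorm n z)\<^sup>2 \<le> (?c * vnorm n y)\<^sup>2"
    proof (cases "?c = 0")
      case True
      then show ?thesis
        using *[of 1] by simp
    next
      case False
      with c have "0 < ?c"
        by simp
      with *[of "1 / ?c"] show ?thesis
        by (simp add: power_mult_distrib field_simps power2_eq_square)
    qed
    then show "vnorm n z \<le> ?c * vnorm n y"
      by (rule power2_le_imp_le) (simp add: c vnorm_nonneg)
  qed
  have "\<psi> a \<in> bounded_ops" if "a \<in> bounded_ops" for a
    unfolding bounded_ops_iff
    by (intro allI rinner_eqI) (simp add: \<psi> rinner_scaleC_right B_scaleC[OF that])
  moreover have "\<psi> (a + b) = \<psi> a + \<psi> b" for a b
    by (rule eqI) (simp add: \<psi> blinfun.add_left rinner_add_right B_add)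
  moreover have "\<psi> (scaleC_op c a) = scaleC_op c (\<psi> a)" for c a
    by (rule eqI) (simp add: \<psi> scaleC_op_apply rinner_scaleC_right B_scaleC_op)
  moreover have "\<psi> id_blinfun = id_blinfun"
    using extends[OF Zs(1)] \<phi> by (simp add: ucc_op_space_iff)
  ultimately have "ucc (op_space bounded_ops) (op_space bounded_ops) \<psi>"
    unfolding ucc_op_space_iff using contractive by blast
  then show ?thesis
    using extends by blast
qed

section \<open>Unital complete contractions preserve adjoints\<close>

lemma accretive_1: "accretive 1 (\<lambda>_ _. a) \<longleftrightarrow> (\<forall>x. 0 \<le> rinner x (blinfun_apply a x))"
  unfolding accretive_def matrix_apply_def by (auto simp: lessThan_Suc dest: spec[of _ "\<lambda>_. _"])

text \<open>Both \<open>S - T\<close> and \<open>\<i> (S + T)\<close> have real part zero if \<open>S\<close> is the adjoint of \<open>T\<close>. An operator has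
  real part zero if and only if it and its negative are accretive, so their images have real part
  zero, and polarising the two resulting identities gives the claim.\<close>

lemma ucc_adjoint:
  fixes \<phi> :: "('k :: complex_hilbert_space \<Rightarrow>\<^sub>L 'k) \<Rightarrow> ('h :: complex_hilbert_space \<Rightarrow>\<^sub>L 'h)"
  assumes \<phi>: "ucc (op_space bounded_ops) (op_space bounded_ops) \<phi>"
    and S: "S \<in> bounded_ops" and T: "T \<in> bounded_ops" and adj: "is_adjoint S T"
  shows "is_adjoint (\<phi> S) (\<phi> T)"
proof -
  note Z = concrete_operator_spaceD[OF concrete_operator_space_bounded_ops]
  have zero: "rinner x (blinfun_apply (\<phi> a) x) = 0"
    if a: "a \<in> bounded_ops" and 0: "\<And>y. rinner y (blinfun_apply a y) = 0" for a x
  proof -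
    have "0 \<le> rinner x (blinfun_apply (\<phi> (scaleC_op (complex_of_real r) a)) x)" for r
    proof -
      have "accretive 1 (\<lambda>_ _. scaleC_op (complex_of_real r) a)"
        by (simp only: accretive_1 scaleC_op_of_real blinfun.scaleR_left rinner.scaleR_right 0) simp
      from ucc_accretive[OF concrete_operator_space_bounded_ops \<phi> _ this] Z(4)[OF a]
      show ?thesis
        by (simp only: accretive_1)
    qed
    moreover have "\<phi> (scaleC_op (complex_of_real r) a) = r *\<^sub>R \<phi> a" for r
      using \<phi> a unfolding ucc_op_space_iff scaleC_op_of_real[of r "\<phi> a", symmetric] by blast
    ultimately have "0 \<le> r * rinner x (blinfun_apply (\<phi> a) x)" for r
      by (simp add: blinfun.scaleR_left rinner.scaleR_right)
    from this[of 1] this[of "- 1"] show ?thesis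
      by simp
  qed
  have polar: "rinner x (blinfun_apply (\<phi> a) y) + rinner y (blinfun_apply (\<phi> a) x) = 0"
    if "a \<in> bounded_ops" "\<And>y. rinner y (blinfun_apply a y) = 0" for a x y
    using zero[OF that, of "x + y"] zero[OF that, of x] zero[OF that, of y]
    by (simp add: blinfun.add_right rinner_add_left rinner_add_right)
  have adj': "rinner (blinfun_apply S x) y = rinner x (blinfun_apply T y)" for x y
    using adj T by (simp add: is_adjoint_iff_rinner)
  have \<phi>_lin: "\<phi> (S - T) = \<phi> S - \<phi> T" "\<phi> (scaleC_op \<i> (S + T)) = scaleC_op \<i> (\<phi> S) + scaleC_op \<i> (\<phi> T)"
  proof -
    have "\<phi> ((S - T) + T) = \<phi> (S - T) + \<phi> T"
      using \<phi> Z(7)[OF S T] T unfolding ucc_op_space_iff by blast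
    then show "\<phi> (S - T) = \<phi> S - \<phi> T"
      by simp
    show "\<phi> (scaleC_op \<i> (S + T)) = scaleC_op \<i> (\<phi> S) + scaleC_op \<i> (\<phi> T)"
      using \<phi> Z(3)[OF S T] S T unfolding ucc_op_space_iff by (simp flip: cop.scale_right_distrib)
  qed
  have bnd: "\<phi> S \<in> bounded_ops" "\<phi> T \<in> bounded_ops"
    using \<phi> S T by (auto simp: ucc_op_space_iff)
  have ii: "rinner (\<i> *\<^sub>C u) (\<i> *\<^sub>C v) = rinner u v" "rinner u (\<i> *\<^sub>C \<i> *\<^sub>C v) = - rinner u v"
    for u v :: "'a :: complex_hilbert_space"
    using scaleC_of_real[of 1 u] scaleC_of_real[of "- 1" v]
    by (simp_all add: rinner_scaleC_right scaleC_scaleC rinner_def cinner_scaleC_right cinner_scaleC_left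
        rinner.minus_right[unfolded rinner_def])
  have "rinner (blinfun_apply (\<phi> S) x) y = rinner x (blinfun_apply (\<phi> T) y)" for x y
  proof -
    have "rinner x (blinfun_apply (\<phi> (S - T)) y) + rinner y (blinfun_apply (\<phi> (S - T)) x) = 0"
      by (rule polar[OF Z(7)[OF S T]])
        (simp add: blinfun.diff_left rinner.diff_right rinner_commute[of _ "blinfun_apply S _"] adj')
    moreover have "rinner x (blinfun_apply (\<phi> (scaleC_op \<i> (S + T))) (\<i> *\<^sub>C y))
        + rinner (\<i> *\<^sub>C y) (blinfun_apply (\<phi> (scaleC_op \<i> (S + T))) x) = 0"
    proof (rule polar[OF Z(4)[OF Z(3)[OF S T]]])
      fix u
      have "rinner u (\<i> *\<^sub>C blinfun_apply T u) = rinner (cnj \<i> *\<^sub>C u) (blinfun_apply T u)"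
        by (rule rinner_scaleC_right)
      also have "\<dots> = rinner (cnj \<i> *\<^sub>C blinfun_apply S u) u"
        using S by (simp add: adj'[symmetric] bounded_ops_iff)
      also have "\<dots> = - rinner u (\<i> *\<^sub>C blinfun_apply S u)"
        by (subst rinner_commute) (simp add: rinner_def cinner_scaleC_right)
      finally show "rinner u (blinfun_apply (scaleC_op \<i> (S + T)) u) = 0"
        by (simp add: scaleC_op_apply blinfun.add_left scaleC_add_right rinner_add_right)
    qed
    \<comment> \<open>With \<open>\<i> y\<close> in place of \<open>y\<close> in the second identity, the sum of the two is twice the claim.\<close>
    ultimately show ?thesis
      using bnd by (simp add: \<phi>_lin blinfun.diff_left blinfun.add_left rinner.diff_right rinner_add_right
          scaleC_op_apply bounded_ops_iff ii rinner_commute[of "blinfun_apply (\<phi> S) x"])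
  qed
  then show ?thesis
    using bnd by (simp add: is_adjoint_iff_rinner)
qed

section \<open>Quotients and boundary subsystems\<close>

lemma mem_quot_map: "S \<in> quot_map I T \<longleftrightarrow> S - T \<in> I"
  by (auto simp: quot_map_def elt_set_plus_def intro: bexI[of _ "S - T"])

lemma quot_map_eq_iff:
  assumes "cop.subspace I"
  shows "quot_map I S = quot_map I T \<longleftrightarrow> S - T \<in> I"
proof
  assume "quot_map I S = quot_map I T"
  then show "S - T \<in> I"
    using mem_quot_map[of S I S] mem_quot_map[of S I T] cop.subspace_0[OF assms] by simp
next
  assume ST: "S - T \<in> I"
  show "quot_map I S = quot_map I T"
  proof (rule set_eqI)
    fix R
    have "R - T \<in> I" if "R - S \<in> I"
      using cop.subspace_add[OF assms that ST] by simp
    moreover have "R - S \<in> I" if "R - T \<in> I"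
      using cop.subspace_diff[OF assms that ST] by simp
    ultimately show "R \<in> quot_map I S \<longleftrightarrow> R \<in> quot_map I T"
      by (auto simp: mem_quot_map)
  qed
qed

lemma quotient_norm_le:
  assumes "\<And>i j. i < n \<Longrightarrow> j < n \<Longrightarrow> a i j \<in> A i j"
  shows "mnorm (quotient_space I) n A \<le> op_matrix_norm n a"
proof -
  have "bdd_below {op_matrix_norm n a | a. \<forall>i<n. \<forall>j<n. a i j \<in> A i j}"
    by (rule bdd_belowI[of _ 0]) (auto simp: op_matrix_norm_nonneg)
  then show ?thesis
    using assms by (auto simp: quotient_space_def intro!: cInf_lower)
qed

lemma quotient_norm_greatest:
  assumes "\<And>i j. i < n \<Longrightarrow> j < n \<Longrightarrow> a i j \<in> A i j"
    and "\<And>b. (\<And>i j. i < n \<Longrightarrow> j < n \<Longrightarrow> b i j \<in> A i j) \<Longrightarrow> c \<le> op_matrix_norm n b"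
  shows "c \<le> mnorm (quotient_space I) n A"
proof -
  have "op_matrix_norm n a \<in> {op_matrix_norm n a | a. \<forall>i<n. \<forall>j<n. a i j \<in> A i j}"
    using assms(1) by blast
  then show ?thesis
    using assms(2) by (auto simp: quotient_space_def intro!: cInf_greatest)
qed

lemma linear_map_quot_map:
  assumes "cop.subspace I" and "concrete_operator_space Y"
  shows "linear_map (op_space Y) (quotient_space I) (quot_map I)"
  using quotient_space_operations[OF assms(1)] concrete_operator_spaceD(5)[OF assms(2)]
  unfolding linear_map_def by (auto simp: op_space_def) (auto simp: quotient_space_def)

lemma ucc_quot_map:
  assumes I: "cop.subspace I" and Y: "concrete_operator_space Y"
  shows "ucc (op_space Y) (quotient_space I) (quot_map I)"
proof -
  have "mnorm (quotient_space I) n (\<lambda>i j. quot_map I (a i j)) \<le> op_matrix_norm n a" for n a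
    by (rule quotient_norm_le) (simp add: mem_quot_map cop.subspace_0[OF I])
  then show ?thesis
    using linear_map_quot_map[OF I Y]
    by (simp add: ucc_def completely_contractive_def op_space_def quotient_space_def)
qed

text \<open>The quotient norm of a matrix over \<open>X\<close> never exceeds its norm, so being completely isometric means
  that adding elements of \<open>I\<close> to the entries does not decrease the norm.\<close>

lemma boundary_subsystem_iff:
  assumes X: "concrete_operator_space X"
  shows "boundary_subsystem X I \<longleftrightarrow> I \<subseteq> bounded_ops \<and> cop.subspace I \<and> selfadjoint_set I
    \<and> (\<forall>n\<ge>1. \<forall>a b. (\<forall>i<n. \<forall>j<n. a i j \<in> X \<and> b i j - a i j \<in> I)
        \<longrightarrow> op_matrix_norm n a \<le> op_matrix_norm n b)"
    (is "_ \<longleftrightarrow> ?base \<and> ?sub \<and> ?self \<and> ?norm")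
proof -
  have "completely_isometric (op_space X) (quotient_space I) (quot_map I) \<longleftrightarrow> ?norm" if I: "cop.subspace I"
  proof
    assume iso: "completely_isometric (op_space X) (quotient_space I) (quot_map I)"
    show ?norm
    proof (intro allI impI)
      fix n :: nat and a b :: "nat \<Rightarrow> nat \<Rightarrow> ('a \<Rightarrow>\<^sub>L 'a)"
      assume n: "1 \<le> n" and ab: "\<forall>i<n. \<forall>j<n. a i j \<in> X \<and> b i j - a i j \<in> I"
      have "op_matrix_norm n a = mnorm (quotient_space I) n (\<lambda>i j. quot_map I (a i j))"
        using iso n ab by (simp add: completely_isometric_def op_space_def matrices_def)
      also have "\<dots> \<le> op_matrix_norm n b"
        by (rule quotient_norm_le) (use ab in \<open>simp add: mem_quot_map\<close>)
      finally show "op_matrix_norm n a \<le> op_matrix_norm n b" .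
    qed
  next
    assume norm: ?norm
    have "mnorm (quotient_space I) n (\<lambda>i j. quot_map I (a i j)) = op_matrix_norm n a"
      if n: "1 \<le> n" and a: "\<forall>i<n. \<forall>j<n. a i j \<in> X" for n a
    proof (rule order_antisym)
      have aa: "a i j \<in> quot_map I (a i j)" for i j
        by (simp add: mem_quot_map cop.subspace_0[OF I])
      then show "mnorm (quotient_space I) n (\<lambda>i j. quot_map I (a i j)) \<le> op_matrix_norm n a"
        by (rule quotient_norm_le)
      show "op_matrix_norm n a \<le> mnorm (quotient_space I) n (\<lambda>i j. quot_map I (a i j))"
        by (rule quotient_norm_greatest[OF aa]) (use norm n a in \<open>simp add: mem_quot_map\<close>)
    qed
    then show "completely_isometric (op_space X) (quotient_space I) (quot_map I)"
      using linear_map_quot_map[OF I X]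
      by (simp add: completely_isometric_def op_space_def matrices_def)
  qed
  then show ?thesis
    by (auto simp: boundary_subsystem_def)
qed

section \<open>Annihilating maps\<close>

definition X_map_annihilating :: "('h :: complex_hilbert_space \<Rightarrow>\<^sub>L 'h) set \<Rightarrow> ('h \<Rightarrow>\<^sub>L 'h) set
    \<Rightarrow> (('h \<Rightarrow>\<^sub>L 'h) \<Rightarrow> ('h \<Rightarrow>\<^sub>L 'h)) \<Rightarrow> bool"
  where "X_map_annihilating X I \<phi> \<longleftrightarrow> ucc (op_space bounded_ops) (op_space bounded_ops) \<phi>
    \<and> (\<forall>x\<in>X. \<phi> x = x) \<and> (\<forall>y\<in>I. \<phi> y = 0)"

text \<open>The map \<open>\<rho>\<close> below is \<open>x + y \<mapsto> x\<close> on \<open>Z = X + I\<close>. Both its being well defined and its being a complete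
  contraction are instances of the characterisation of boundary subsystems.\<close>

lemma X_map_annihilating_exists:
  fixes X I :: "('h :: complex_hilbert_space \<Rightarrow>\<^sub>L 'h) set"
  assumes X: "concrete_operator_space X" and I: "boundary_subsystem X I"
  shows "\<exists>\<phi>. X_map_annihilating X I \<phi>"
proof -
  note Xs = concrete_operator_spaceD[OF X]
  have I_sub: "I \<subseteq> bounded_ops" "cop.subspace I"
    and iso: "\<And>n a b. n \<ge> 1 \<Longrightarrow> \<forall>i<n. \<forall>j<n. a i j \<in> X \<and> b i j - a i j \<in> I
        \<Longrightarrow> op_matrix_norm n a \<le> op_matrix_norm n b"
    using I unfolding boundary_subsystem_iff[OF X] by blast+
  note Is = cop.subspace_0[OF I_sub(2)] cop.subspace_add[OF I_sub(2)] cop.subspace_scale[OF I_sub(2)]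
    cop.subspace_diff[OF I_sub(2)]
  define Z where "Z = {z. \<exists>x\<in>X. z - x \<in> I}"
  define \<rho> where "\<rho> z = (SOME x. x \<in> X \<and> z - x \<in> I)" for z
  have unique: "x = x'" if x: "x \<in> X" "z - x \<in> I" and x': "x' \<in> X" "z - x' \<in> I" for x x' z
  proof -
    have d: "x - x' \<in> X" "0 - (x - x') \<in> I"
      using Xs(7)[OF x(1) x'(1)] Is(4)[OF x(2) x'(2)] by auto
    have "op_matrix_norm 1 (\<lambda>_ _. x - x') \<le> op_matrix_norm 1 (\<lambda>_ _. 0 :: 'h \<Rightarrow>\<^sub>L 'h)"
      by (rule iso) (use d in auto)
    also have "\<dots> \<le> 0"
      by (rule op_matrix_norm_leI) (simp_all add: matrix_apply_def vnorm_def L2_set_def)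
    finally show ?thesis
      using op_matrix_norm_1_eq_0[of "x - x'"] op_matrix_norm_nonneg[of 1 "\<lambda>_ _. x - x'"] by simp
  qed
  have \<rho>: "\<rho> z \<in> X" "z - \<rho> z \<in> I" if "z \<in> Z" for z
    using someI_ex[of "\<lambda>x. x \<in> X \<and> z - x \<in> I"] that by (auto simp: Z_def \<rho>_def)
  have \<rho>_eq: "z \<in> Z" "\<rho> z = x" if "x \<in> X" "z - x \<in> I" for x z
  proof -
    show "z \<in> Z"
      using that by (auto simp: Z_def)
    then show "\<rho> z = x"
      using unique[OF \<rho> that] by simp
  qed
  have X_Z: "x \<in> Z" "\<rho> x = x" if "x \<in> X" for x
    using \<rho>_eq[of x x] that Is(1) by auto
  have add: "S + T \<in> Z" "\<rho> (S + T) = \<rho> S + \<rho> T" if "S \<in> Z" "T \<in> Z" for S T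
  proof -
    have "S + T - (\<rho> S + \<rho> T) \<in> I"
      using Is(2)[OF \<rho>(2)[OF that(1)] \<rho>(2)[OF that(2)]] by (simp add: add_diff_add)
    with Xs(3)[OF \<rho>(1)[OF that(1)] \<rho>(1)[OF that(2)]]
    show "S + T \<in> Z" "\<rho> (S + T) = \<rho> S + \<rho> T"
      by (auto intro: \<rho>_eq)
  qed
  have scale: "scaleC_op c T \<in> Z" "\<rho> (scaleC_op c T) = scaleC_op c (\<rho> T)" if "T \<in> Z" for c T
    using \<rho>_eq[of "scaleC_op c (\<rho> T)" "scaleC_op c T"] Xs(4)[OF \<rho>(1)[OF that]]
      Is(3)[OF \<rho>(2)[OF that], of c] by (simp_all add: cop.scale_right_diff_distrib)
  have "T \<in> bounded_ops" if "T \<in> Z" for T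
    using concrete_operator_spaceD(3)[OF concrete_operator_space_bounded_ops, of "T - \<rho> T" "\<rho> T"]
      \<rho>[OF that] Xs(5) I_sub(1) by auto
  then have Z: "concrete_operator_space Z"
    using add(1) scale(1) X_Z(1)[OF Xs(1)] X_Z(1)[OF Xs(2)]
    by (auto simp: concrete_operator_space_def cop.subspace_def)
  have "op_matrix_norm n (\<lambda>i j. \<rho> (a i j)) \<le> op_matrix_norm n a"
    if "n \<ge> 1" "\<forall>i<n. \<forall>j<n. a i j \<in> Z" for n a
    by (rule iso) (use that \<rho> in auto)
  then have "ucc (op_space Z) (op_space bounded_ops) \<rho>"
    using add(2) scale(2) X_Z(2)[OF Xs(1)] \<rho>(1) Xs(5) by (auto simp: ucc_op_space_iff)
  from ucc_extension[OF Z this] obtain \<phi> where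
    \<phi>: "ucc (op_space bounded_ops) (op_space bounded_ops) \<phi>" "\<forall>z\<in>Z. \<phi> z = \<rho> z"
    by blast
  have "y \<in> Z" "\<rho> y = 0" if "y \<in> I" for y
    using \<rho>_eq[of 0 y] that Xs(2) by auto
  then show ?thesis
    using \<phi> X_Z unfolding X_map_annihilating_def by metis
qed

text \<open>By maximality it suffices that \<open>J = (1 - \<phi>)(B(H))\<close> is a boundary subsystem containing \<open>I\<close>. Let
  \<open>d = x + a - \<phi>(a)\<close> with \<open>x\<close> over \<open>X\<close>. The sum of \<open>\<phi>\<^sup>k(d)\<close> over \<open>1 \<le> k \<le> N\<close> telescopes to
  \<open>s\<^sub>N = N x + \<phi>(a) - \<phi>\<^bsup>N + 1\<^esup>(a)\<close>. So \<open>\<parallel>s\<^sub>N\<parallel> \<le> N \<parallel>d\<parallel>\<close>, which yields \<open>N \<parallel>x\<parallel> \<le> N \<parallel>d\<parallel> + 2 \<parallel>a\<parallel>\<close> for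
  all \<open>N\<close> and hence \<open>\<parallel>x\<parallel> \<le> \<parallel>d\<parallel>\<close>.\<close>

lemma X_map_complement_in_boundary:
  fixes X I :: "('h :: complex_hilbert_space \<Rightarrow>\<^sub>L 'h) set"
  assumes X: "concrete_operator_space X" and max: "maximal_boundary_subsystem X I"
    and r: "X_map_annihilating X I \<phi>" and b: "b \<in> bounded_ops"
  shows "b - \<phi> b \<in> I"
proof -
  note Xs = concrete_operator_spaceD[OF X]
  note Bs = concrete_operator_spaceD[OF concrete_operator_space_bounded_ops[where 'h = 'h]]
  have \<phi>: "ucc (op_space bounded_ops) (op_space bounded_ops) \<phi>"
    and fix_X: "\<And>x. x \<in> X \<Longrightarrow> \<phi> x = x" and kill_I: "\<And>y. y \<in> I \<Longrightarrow> \<phi> y = 0"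
    using r by (auto simp: X_map_annihilating_def)
  have \<phi>_B: "\<phi> a \<in> bounded_ops" if "a \<in> bounded_ops" for a
    using \<phi> that by (simp add: ucc_op_space_iff)
  have \<phi>_add: "\<phi> (a + c) = \<phi> a + \<phi> c" if "a \<in> bounded_ops" "c \<in> bounded_ops" for a c
    using \<phi> that by (simp add: ucc_op_space_iff)
  have \<phi>_scale: "\<phi> (scaleC_op t a) = scaleC_op t (\<phi> a)" if "a \<in> bounded_ops" for a t
    using \<phi> that by (simp add: ucc_op_space_iff)
  have \<phi>_scaleR: "\<phi> (t *\<^sub>R a) = t *\<^sub>R \<phi> a" if "a \<in> bounded_ops" for a t
    using \<phi>_scale[OF that] by (metis scaleC_op_of_real)
  have \<phi>_diff: "\<phi> (a - c) = \<phi> a - \<phi> c" if "a \<in> bounded_ops" "c \<in> bounded_ops" for a c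
    using \<phi>_add[OF Bs(7)[OF that] that(2)] by simp
  have \<phi>_norm: "op_matrix_norm n (\<lambda>i j. \<phi> (a i j)) \<le> op_matrix_norm n a"
    if "n \<ge> 1" "\<And>i j. i < n \<Longrightarrow> j < n \<Longrightarrow> a i j \<in> bounded_ops" for n a
    using \<phi> that by (simp add: ucc_op_space_iff)
  define J where "J = (\<lambda>b. b - \<phi> b) ` bounded_ops"
  have "cop.subspace J"
  proof (rule cop.subspaceI)
    show "0 \<in> J"
      using \<phi>_scale[OF Bs(2), of 0] Bs(2) by (auto simp: J_def image_iff intro: bexI[of _ 0])
    show "S + T \<in> J" if ST: "S \<in> J" "T \<in> J" for S T
    proof -
      obtain a c where "a \<in> bounded_ops" "c \<in> bounded_ops" "S = a - \<phi> a" "T = c - \<phi> c"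
        using ST by (auto simp: J_def)
      then have "S + T = (a + c) - \<phi> (a + c)" "a + c \<in> bounded_ops"
        using Bs(3) by (auto simp: \<phi>_add)
      then show ?thesis
        unfolding J_def by blast
    qed
    show "scaleC_op t S \<in> J" if S: "S \<in> J" for t S
    proof -
      obtain a where "a \<in> bounded_ops" "S = a - \<phi> a"
        using S by (auto simp: J_def)
      then have "scaleC_op t S = scaleC_op t a - \<phi> (scaleC_op t a)" "scaleC_op t a \<in> bounded_ops"
        using Bs(4) by (auto simp: \<phi>_scale cop.scale_right_diff_distrib)
      then show ?thesis
        unfolding J_def by blast
    qed
  qed
  moreover have "J \<subseteq> bounded_ops"
    using \<phi>_B Bs(7) by (auto simp: J_def)
  moreover have "selfadjoint_set J"
    unfolding selfadjoint_set_def
  proof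
    fix T assume "T \<in> J"
    then obtain a where a: "a \<in> bounded_ops" "T = a - \<phi> a"
      by (auto simp: J_def)
    obtain c where c: "c \<in> bounded_ops" "is_adjoint c a"
      using adjoint_exists[OF a(1)] by blast
    have "is_adjoint (c - \<phi> c) (a - \<phi> a)"
      using c(2) ucc_adjoint[OF \<phi> c(1) a(1) c(2)]
      unfolding is_adjoint_iff_rinner[OF a(1)] is_adjoint_iff_rinner[OF \<phi>_B[OF a(1)]]
        is_adjoint_iff_rinner[OF Bs(7)[OF a(1) \<phi>_B[OF a(1)]]]
      by (simp add: blinfun.diff_left rinner.diff_left rinner.diff_right)
    then show "\<exists>S\<in>J. is_adjoint S T"
      using c(1) a(2) by (auto simp: J_def)
  qed
  moreover have "op_matrix_norm n x \<le> op_matrix_norm n d"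
    if n: "n \<ge> 1" and xd: "\<forall>i<n. \<forall>j<n. x i j \<in> X \<and> d i j - x i j \<in> J" for n x d
  proof -
    have "\<exists>a\<in>bounded_ops. d i j - x i j = a - \<phi> a" if "i < n" "j < n" for i j
      using xd that by (auto simp: J_def)
    then obtain a where a: "\<And>i j. i < n \<Longrightarrow> j < n \<Longrightarrow> a i j \<in> bounded_ops"
      and d: "\<And>i j. i < n \<Longrightarrow> j < n \<Longrightarrow> d i j - x i j = a i j - \<phi> (a i j)"
      by metis
    have x: "x i j \<in> X" "x i j \<in> bounded_ops" "\<phi> (x i j) = x i j" if "i < n" "j < n" for i j
      using xd that Xs(5) fix_X by auto
    have d_eq: "d i j = x i j + (a i j - \<phi> (a i j))" "d i j \<in> bounded_ops" if "i < n" "j < n" for i j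
    proof -
      show "d i j = x i j + (a i j - \<phi> (a i j))"
        using d[OF that] by (simp add: algebra_simps)
      then show "d i j \<in> bounded_ops"
        using Bs(3,7) \<phi>_B x(2)[OF that] a[OF that] by simp
    qed
    define s where "s N i j = real N *\<^sub>R x i j + (\<phi> (a i j) - \<phi> ((\<phi> ^^ N) (a i j)))" for N i j
    have iterate: "(\<phi> ^^ N) c \<in> bounded_ops" if "c \<in> bounded_ops" for N c
      using that by (induction N) (auto simp: \<phi>_B)
    have s_B: "s N i j \<in> bounded_ops" if "i < n" "j < n" for N i j
      unfolding s_def using Bs(3,6,7) \<phi>_B iterate a[OF that] x(2)[OF that] by auto
    have s_Suc: "s (Suc N) i j = \<phi> (d i j + s N i j)" if "i < n" "j < n" for N i j
    proof -
      have "\<phi> (d i j) = x i j + (\<phi> (a i j) - \<phi> (\<phi> (a i j)))"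
        using a[OF that] x[OF that] \<phi>_B Bs(7) by (simp add: d_eq(1)[OF that] \<phi>_add \<phi>_diff)
      moreover have "\<phi> (s N i j) = real N *\<^sub>R x i j + (\<phi> (\<phi> (a i j)) - \<phi> (\<phi> ((\<phi> ^^ N) (a i j))))"
        unfolding s_def using a[OF that] x[OF that] \<phi>_B Bs(6,7) iterate
        by (simp add: \<phi>_add \<phi>_diff \<phi>_scaleR)
      ultimately show ?thesis
        using \<phi>_add[OF d_eq(2)[OF that] s_B[OF that, of N]]
        by (simp add: s_def scaleR_left_distrib)
    qed
    have s_norm: "op_matrix_norm n (s N) \<le> real N * op_matrix_norm n d" for N
    proof (induction N)
      case 0
      have "s 0 = (\<lambda>i j. 0)"
        by (simp add: s_def fun_eq_iff)
      then show ?case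
        by (auto intro!: op_matrix_norm_leI simp: matrix_apply_def vnorm_def L2_set_def)
    next
      case (Suc N)
      have "op_matrix_norm n (s (Suc N)) = op_matrix_norm n (\<lambda>i j. \<phi> (d i j + s N i j))"
        by (rule op_matrix_norm_cong) (rule s_Suc)
      also have "\<dots> \<le> op_matrix_norm n (\<lambda>i j. d i j + s N i j)"
        by (rule \<phi>_norm[OF n]) (intro Bs(3) d_eq(2) s_B)
      also have "\<dots> \<le> op_matrix_norm n d + op_matrix_norm n (s N)"
        by (rule op_matrix_norm_triangle)
      finally show ?case
        using Suc by (simp add: distrib_right)
    qed
    have a_norm: "op_matrix_norm n (\<lambda>i j. \<phi> ((\<phi> ^^ N) (a i j))) \<le> op_matrix_norm n a" for N
    proof (induction N)
      case 0
      show ?case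
        using \<phi>_norm[OF n a] by simp
    next
      case (Suc N)
      have "op_matrix_norm n (\<lambda>i j. \<phi> (\<phi> ((\<phi> ^^ N) (a i j)))) \<le> op_matrix_norm n (\<lambda>i j. \<phi> ((\<phi> ^^ N) (a i j)))"
        by (rule \<phi>_norm[OF n]) (intro \<phi>_B iterate a)
      then show ?case
        using Suc by simp
    qed
    have "real N * op_matrix_norm n x \<le> real N * op_matrix_norm n d + 2 * op_matrix_norm n a" for N
    proof (cases "N = 0")
      case False
      have "op_matrix_norm n (\<lambda>i j. real N *\<^sub>R x i j)
          = op_matrix_norm n (\<lambda>i j. s N i j + (\<phi> ((\<phi> ^^ N) (a i j)) + - 1 *\<^sub>R \<phi> (a i j)))"
        by (rule op_matrix_norm_cong) (simp add: s_def)
      also have "\<dots> \<le> op_matrix_norm n (s N) + (op_matrix_norm n (\<lambda>i j. \<phi> ((\<phi> ^^ N) (a i j)))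
          + op_matrix_norm n (\<lambda>i j. - 1 *\<^sub>R \<phi> (a i j)))"
        by (intro order_trans[OF op_matrix_norm_triangle] add_left_mono op_matrix_norm_triangle)
      also have "op_matrix_norm n (\<lambda>i j. - 1 *\<^sub>R \<phi> (a i j)) \<le> op_matrix_norm n (\<lambda>i j. \<phi> (a i j))"
        using op_matrix_norm_scaleR[of n "- 1" "\<lambda>i j. \<phi> (a i j)"] by simp
      finally have "op_matrix_norm n (\<lambda>i j. real N *\<^sub>R x i j) \<le> real N * op_matrix_norm n d + 2 * op_matrix_norm n a"
        using s_norm[of N] a_norm[of N] a_norm[of 0] by simp
      moreover have "op_matrix_norm n (\<lambda>i j. inverse (real N) *\<^sub>R real N *\<^sub>R x i j)
          \<le> \<bar>inverse (real N)\<bar> * op_matrix_norm n (\<lambda>i j. real N *\<^sub>R x i j)"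
        by (rule op_matrix_norm_scaleR)
      ultimately show ?thesis
        using False by (simp add: field_simps)
    qed (simp add: op_matrix_norm_nonneg)
    then have *: "real N * (op_matrix_norm n x - op_matrix_norm n d) \<le> 2 * op_matrix_norm n a" for N
      by (simp add: algebra_simps)
    show ?thesis
    proof (rule ccontr)
      assume "\<not> ?thesis"
      then obtain N :: nat where "2 * op_matrix_norm n a < real N * (op_matrix_norm n x - op_matrix_norm n d)"
        using reals_Archimedean3[of "op_matrix_norm n x - op_matrix_norm n d"] by auto
      then show False
        using *[of N] by simp
    qed
  qed
  ultimately have "boundary_subsystem X J"
    unfolding boundary_subsystem_iff[OF X] by blast
  \<comment> \<open>An element \<open>y\<close> of \<open>I\<close> is killed by \<open>\<phi>\<close> and so equals \<open>y - \<phi>(y)\<close>.\<close>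
  moreover have "I \<subseteq> J"
  proof
    fix y assume y: "y \<in> I"
    have "I \<subseteq> bounded_ops"
      using max by (simp add: maximal_boundary_subsystem_def boundary_subsystem_def)
    then have "y - \<phi> y \<in> J"
      using y unfolding J_def by blast
    then show "y \<in> J"
      by (simp add: kill_I[OF y])
  qed
  ultimately have "J = I"
    using max by (simp add: maximal_boundary_subsystem_def)
  then show ?thesis
    using b by (auto simp: J_def)
qed


section \<open>The injective envelope\<close>

lemma ucc_comp:
  assumes f: "ucc E F f" and g: "ucc F G g"
  shows "ucc E G (g \<circ> f)"
proof -
  have fF: "f a \<in> carr F" if "a \<in> carr E" for a
    using f that by (auto simp: ucc_def completely_contractive_def linear_map_def)
  have "mnorm G n (\<lambda>i j. g (f (a i j))) \<le> mnorm E n a" if n: "n \<ge> 1" and a: "a \<in> matrices E n" for n a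
  proof -
    have "(\<lambda>i j. f (a i j)) \<in> matrices F n"
      using a fF by (simp add: matrices_def)
    then have "mnorm G n (\<lambda>i j. g (f (a i j))) \<le> mnorm F n (\<lambda>i j. f (a i j))"
      using g n by (simp add: ucc_def completely_contractive_def)
    also have "\<dots> \<le> mnorm E n a"
      using f n a by (simp add: ucc_def completely_contractive_def)
    finally show ?thesis .
  qed
  moreover have "linear_map E G (g \<circ> f)"
    using f g fF by (auto simp: ucc_def completely_contractive_def linear_map_def)
  ultimately show ?thesis
    using f g by (simp add: ucc_def completely_contractive_def)
qed

lemma ucis_imp_ucc: "ucis E F f \<Longrightarrow> ucc E F f"
  by (simp add: ucis_def ucc_def completely_isometric_def completely_contractive_def)

lemma ucc_restrict_domain: "ucc (op_space W) F f \<Longrightarrow> V \<subseteq> W \<Longrightarrow> ucc (op_space V) F f"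
  by (auto simp: ucc_def completely_contractive_def linear_map_def op_space_def matrices_def subset_iff)

lemma ucc_restrict_codomain:
  assumes "S \<subseteq> carr F"
  shows "ucc E (F\<lparr>carr := S\<rparr>) f \<longleftrightarrow> ucc E F f \<and> f ` carr E \<subseteq> S"
  using assms by (auto simp: ucc_def completely_contractive_def linear_map_def)

theorem lemma2p6:
  fixes X I :: "('h :: complex_hilbert_space \<Rightarrow>\<^sub>L 'h) set"
  assumes "concrete_operator_space X"
    and "maximal_boundary_subsystem X I"
  shows "injective_envelope TYPE('h) TYPE('k :: complex_hilbert_space) X
           (quotient_space I) (quot_map I)"
proof -
  note X = assms(1) and max = assms(2)
  note Xs = concrete_operator_spaceD[OF X]
  note B = concrete_operator_space_bounded_ops[where 'h = 'h]
  note Bs = concrete_operator_spaceD[OF B]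
  have I: "boundary_subsystem X I"
    using max by (simp add: maximal_boundary_subsystem_def)
  then have I_sub: "cop.subspace I" and I_B: "I \<subseteq> bounded_ops"
    by (auto simp: boundary_subsystem_def)
  let ?E = "quotient_space I" and ?q = "quot_map I"
  obtain \<phi> where r: "X_map_annihilating X I \<phi>"
    using X_map_annihilating_exists[OF X I] by blast
  then have \<phi>: "ucc (op_space bounded_ops) (op_space bounded_ops) \<phi>"
    and fix_X: "\<And>x. x \<in> X \<Longrightarrow> \<phi> x = x" and kill_I: "\<And>y. y \<in> I \<Longrightarrow> \<phi> y = 0"
    by (auto simp: X_map_annihilating_def)
  have \<phi>_B: "\<phi> a \<in> bounded_ops" if "a \<in> bounded_ops" for a
    using \<phi> that by (simp add: ucc_op_space_iff)
  have \<phi>_add: "\<phi> (a + c) = \<phi> a + \<phi> c" if "a \<in> bounded_ops" "c \<in> bounded_ops" for a c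
    using \<phi> that by (simp add: ucc_op_space_iff)
  have \<phi>_scale: "\<phi> (scaleC_op t a) = scaleC_op t (\<phi> a)" if "a \<in> bounded_ops" for a t
    using \<phi> that by (simp add: ucc_op_space_iff)
  have \<phi>_norm: "op_matrix_norm n (\<lambda>i j. \<phi> (a i j)) \<le> op_matrix_norm n a"
    if "n \<ge> 1" "\<And>i j. i < n \<Longrightarrow> j < n \<Longrightarrow> a i j \<in> bounded_ops" for n a
    using \<phi> that by (simp add: ucc_op_space_iff)
  have \<phi>_id: "\<phi> id_blinfun = id_blinfun"
    using \<phi> by (simp add: ucc_op_space_iff)
  have \<phi>_cong: "\<phi> a = \<phi> c" if "a - c \<in> I" "c \<in> bounded_ops" for a c
    using \<phi>_add[of "a - c" c] kill_I[OF that(1)] that I_B by auto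
  have q_\<phi>: "?q (\<phi> a) = ?q a" if "a \<in> bounded_ops" for a
    using X_map_complement_in_boundary[OF X max r that]
    by (simp add: quot_map_eq_iff[OF I_sub, symmetric])
  have idem: "\<phi> (\<phi> a) = \<phi> a" if "a \<in> bounded_ops" for a
    by (rule \<phi>_cong) (use q_\<phi>[OF that] that in \<open>simp_all add: quot_map_eq_iff[OF I_sub]\<close>)
  have carr_E: "carr ?E = ?q ` bounded_ops" and unit_E: "vunit ?E = ?q id_blinfun"
    by (simp_all add: quotient_space_def)
  note ops_E = quotient_space_operations[OF I_sub]
  have q_mem: "a \<in> ?q a" for a
    by (simp add: mem_quot_map cop.subspace_0[OF I_sub])
  \<comment> \<open>\<open>\<sigma>\<close> is the map \<open>a + I \<mapsto> \<phi>(a)\<close>; since \<open>\<phi>\<close> kills \<open>I\<close>, the chosen representative is irrelevant.\<close>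
  define \<sigma> where "\<sigma> A = \<phi> (SOME a. a \<in> A)" for A
  have \<sigma>_q: "\<sigma> (?q a) = \<phi> a" if "a \<in> bounded_ops" for a
  proof -
    have "(SOME b. b \<in> ?q a) \<in> ?q a"
      by (rule someI[of "\<lambda>b. b \<in> ?q a"]) (rule q_mem)
    then show ?thesis
      unfolding \<sigma>_def mem_quot_map by (rule \<phi>_cong) (rule that)
  qed
  have q_\<sigma>: "?q (\<sigma> A) = A" if "A \<in> carr ?E" for A
    using that by (auto simp: carr_E \<sigma>_q q_\<phi>)
  define Y where "Y = \<phi> ` bounded_ops"
  have Y_iff: "y \<in> Y \<longleftrightarrow> y \<in> bounded_ops \<and> \<phi> y = y" for y
    using idem \<phi>_B by (force simp: Y_def)
  have Y: "concrete_operator_space Y"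
    unfolding concrete_operator_space_def cop.subspace_def
    using Bs(1-4) \<phi>_id \<phi>_add \<phi>_scale fix_X[OF Xs(2)] by (auto simp: Y_iff)
  have linear_\<sigma>: "linear_map ?E (op_space W) \<sigma>" if "Y \<subseteq> W" for W
    unfolding linear_map_def
  proof (intro conjI ballI allI)
    show "\<sigma> ` carr ?E \<subseteq> carr (op_space W)"
      using that by (auto simp: carr_E op_space_def \<sigma>_q Y_def)
    show "\<sigma> (vadd ?E A C) = vadd (op_space W) (\<sigma> A) (\<sigma> C)" if "A \<in> carr ?E" "C \<in> carr ?E" for A C
      using that Bs(3) by (auto simp: carr_E ops_E \<sigma>_q op_space_def \<phi>_add)
    show "\<sigma> (vscale ?E c A) = vscale (op_space W) c (\<sigma> A)" if "A \<in> carr ?E" for c A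
      using that Bs(4) by (auto simp: carr_E ops_E \<sigma>_q op_space_def \<phi>_scale)
  qed
  have norm_\<sigma>: "op_matrix_norm n (\<lambda>i j. \<sigma> (A i j)) = mnorm ?E n A"
    if n: "n \<ge> 1" and A: "\<And>i j. i < n \<Longrightarrow> j < n \<Longrightarrow> A i j \<in> carr ?E" for n A
  proof (rule order_antisym)
    \<comment> \<open>The quotient norm is attained at the representatives in the range of \<open>\<phi>\<close>.\<close>
    have \<sigma>_mem: "\<sigma> (A i j) \<in> A i j" if "i < n" "j < n" for i j
      using q_mem[of "\<sigma> (A i j)"] q_\<sigma>[OF A[OF that]] by simp
    show "op_matrix_norm n (\<lambda>i j. \<sigma> (A i j)) \<le> mnorm ?E n A"
    proof (rule quotient_norm_greatest[OF \<sigma>_mem])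
      fix b assume b: "\<And>i j. i < n \<Longrightarrow> j < n \<Longrightarrow> b i j \<in> A i j"
      have b': "b i j \<in> bounded_ops \<and> \<sigma> (A i j) = \<phi> (b i j)" if ij: "i < n" "j < n" for i j
      proof -
        obtain a where a: "a \<in> bounded_ops" "A i j = ?q a"
          using A[OF ij] by (auto simp: carr_E)
        then have ba: "b i j - a \<in> I"
          using b[OF ij] by (simp add: mem_quot_map)
        then have "b i j \<in> bounded_ops"
          using Bs(3)[of "b i j - a" a] I_B a(1) by auto
        then show ?thesis
          using a \<phi>_cong[OF ba a(1)] by (simp add: \<sigma>_q)
      qed
      have "op_matrix_norm n (\<lambda>i j. \<sigma> (A i j)) = op_matrix_norm n (\<lambda>i j. \<phi> (b i j))"
        by (rule op_matrix_norm_cong) (use b' in blast)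
      also have "\<dots> \<le> op_matrix_norm n b"
        by (rule \<phi>_norm[OF n]) (use b' in blast)
      finally show "op_matrix_norm n (\<lambda>i j. \<sigma> (A i j)) \<le> op_matrix_norm n b" .
    qed
    show "mnorm ?E n A \<le> op_matrix_norm n (\<lambda>i j. \<sigma> (A i j))"
      by (rule quotient_norm_le) (rule \<sigma>_mem)
  qed
  have ucis_\<sigma>: "ucis ?E (op_space W) \<sigma>" if "Y \<subseteq> W" for W
    using linear_\<sigma>[OF that] norm_\<sigma> \<sigma>_q[OF Bs(1)] \<phi>_id
    by (auto simp: ucis_def completely_isometric_def matrices_def unit_E) (simp_all add: op_space_def)
  have ucc_\<sigma>: "ucc ?E (op_space bounded_ops) \<sigma>"
    by (rule ucis_imp_ucc[OF ucis_\<sigma>]) (auto simp: Y_iff)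
  have unital_E: "unital_subspace ?E (carr ?E)"
    using Bs(1,3,4) by (auto simp: unital_subspace_def unit_E carr_E ops_E)
  have "bij_betw \<sigma> (carr ?E) Y"
    by (rule bij_betw_byWitness[where f' = ?q]) (auto simp: carr_E \<sigma>_q q_\<phi> Y_def idem \<phi>_B)
  then have "operator_space TYPE('h) ?E"
    unfolding operator_space_def using unital_E Y ucis_\<sigma>[of Y] by blast
  moreover have "ucis (op_space X) ?E ?q"
    using I by (simp add: ucis_def boundary_subsystem_def) (simp add: op_space_def unit_E)
  ultimately have "extension TYPE('h) X ?E ?q"
    by (simp add: extension_def)
  moreover have "injective TYPE('k) ?E"
    unfolding injective_def
  proof (intro allI impI)
    fix Z Y' :: "('k \<Rightarrow>\<^sub>L 'k) set" and \<theta>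
    assume Z: "concrete_operator_space Z" and Y': "concrete_operator_space Y'" and "Z \<subseteq> Y'"
      and \<theta>: "ucc (op_space Z) ?E \<theta>"
    have "ucc (op_space Z) (op_space bounded_ops) (\<sigma> \<circ> \<theta>)"
      by (rule ucc_comp[OF \<theta> ucc_\<sigma>])
    from ucc_extension[OF Z this] obtain \<psi> where
      \<psi>: "ucc (op_space bounded_ops) (op_space bounded_ops) \<psi>" "\<forall>z\<in>Z. \<psi> z = \<sigma> (\<theta> z)"
      by auto
    have "ucc (op_space Y') ?E (?q \<circ> \<psi>)"
    proof (rule ucc_restrict_domain)
      show "ucc (op_space bounded_ops) ?E (?q \<circ> \<psi>)"
        by (rule ucc_comp[OF \<psi>(1) ucc_quot_map[OF I_sub B]])
      show "Y' \<subseteq> bounded_ops"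
        using Y' by (simp add: concrete_operator_space_def)
    qed
    moreover have "(?q \<circ> \<psi>) z = \<theta> z" if "z \<in> Z" for z
    proof -
      have "\<theta> z \<in> carr ?E"
        using \<theta> that by (auto simp: ucc_def completely_contractive_def linear_map_def op_space_def)
      then show ?thesis
        using \<psi>(2) that q_\<sigma> by simp
    qed
    ultimately show "\<exists>\<psi>. ucc (op_space Y') ?E \<psi> \<and> (\<forall>z\<in>Z. \<psi> z = \<theta> z)"
      by blast
  qed
  moreover have "S = carr ?E"
    if S: "unital_subspace ?E S" and X_S: "?q ` X \<subseteq> S" and inj: "injective TYPE('h) (?E\<lparr>carr := S\<rparr>)" for S
  proof -
    have S_E: "S \<subseteq> carr ?E" and S_unit: "?q id_blinfun \<in> S"
      and S_add: "\<And>A C. A \<in> S \<Longrightarrow> C \<in> S \<Longrightarrow> vadd ?E A C \<in> S"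
      and S_scale: "\<And>c A. A \<in> S \<Longrightarrow> vscale ?E c A \<in> S"
      using S by (auto simp: unital_subspace_def unit_E)
    \<comment> \<open>\<open>Z\<close> is the copy of \<open>S\<close> in \<open>B(H)\<close> under the isomorphism of the quotient with \<open>Y\<close>.\<close>
    define Z where "Z = {y \<in> Y. ?q y \<in> S}"
    note Ys = concrete_operator_spaceD[OF Y]
    have "?q 0 \<in> S"
      using S_scale[OF S_unit, of 0] by (simp add: ops_E)
    then have Z: "concrete_operator_space Z"
      unfolding concrete_operator_space_def cop.subspace_def Z_def
      using Ys(1-5) S_unit S_add[unfolded ops_E] S_scale ops_E by (auto simp flip: ops_E)
    have "ucc (op_space Z) (?E\<lparr>carr := S\<rparr>) ?q"
      using ucc_quot_map[OF I_sub Z] unfolding ucc_restrict_codomain[OF S_E]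
      by (auto simp: op_space_def Z_def)
    moreover have "Z \<subseteq> bounded_ops"
      by (auto simp: Z_def Y_iff)
    ultimately obtain \<rho> where \<rho>: "ucc (op_space bounded_ops) (?E\<lparr>carr := S\<rparr>) \<rho>"
      and \<rho>_Z: "\<forall>z\<in>Z. \<rho> z = ?q z"
      using inj[unfolded injective_def, rule_format, OF Z B] by blast
    have \<rho>_S: "\<rho> a \<in> S" if "a \<in> bounded_ops" for a
      using \<rho> that unfolding ucc_restrict_codomain[OF S_E] by (auto simp: op_space_def)
    have "ucc (op_space bounded_ops) (op_space bounded_ops) (\<sigma> \<circ> (\<rho> \<circ> \<phi>))"
      using \<rho> unfolding ucc_restrict_codomain[OF S_E] by (blast intro: ucc_comp \<phi> ucc_\<sigma>)
    moreover have "(\<sigma> \<circ> (\<rho> \<circ> \<phi>)) x = x" if "x \<in> X" for x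
    proof -
      have "x \<in> Z"
        using that X_S Xs(5) fix_X by (auto simp: Z_def Y_iff)
      then show ?thesis
        using \<rho>_Z that Xs(5) fix_X by (simp add: \<sigma>_q)
    qed
    moreover have "(\<sigma> \<circ> (\<rho> \<circ> \<phi>)) y = 0" if "y \<in> I" for y
    proof -
      have "0 \<in> Z"
        by (rule concrete_operator_spaceD(2)[OF Z])
      then show ?thesis
        using \<rho>_Z that fix_X[OF Xs(2)] Bs(2) by (simp add: kill_I \<sigma>_q)
    qed
    ultimately have "X_map_annihilating X I (\<sigma> \<circ> (\<rho> \<circ> \<phi>))"
      by (simp add: X_map_annihilating_def)
    note complement = X_map_complement_in_boundary[OF X max this]
    have "?q b \<in> S" if "b \<in> bounded_ops" for b
    proof -
      have "?q b = ?q (\<sigma> (\<rho> (\<phi> b)))"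
        using complement[OF that] by (simp add: quot_map_eq_iff[OF I_sub])
      also have "\<dots> = \<rho> (\<phi> b)"
        using \<rho>_S[OF \<phi>_B[OF that]] S_E by (intro q_\<sigma>) blast
      finally show ?thesis
        using \<rho>_S[OF \<phi>_B[OF that]] by simp
    qed
    then show ?thesis
      using S_E by (auto simp: carr_E)
  qed
  ultimately show ?thesis
    unfolding injective_envelope_def by blast
qed

end
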